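(* Let $X$ be an infinite-dimensional (real or complex) Banach space with a symmetric basis, equipped with a symmetric norm $\|\cdot\|$. Let $Y\subseteq X$ be a subspace of dimension $d$, where $2\le d<\infty$. Let $E\subseteq S_Y$ be closed and symmetric, and let $J$ be a (bounded linear) projection of $X$ onto $Y$. Then there exists a bounded linear operator $R:X\to X$ with the following two properties: (1) if $x\in X$ and $J(x)\in E$, then $\|R^n(x)\|\to\infty$ as $n\to\infty$; (2) if $x\in X$ and $J(x)\in S_Y\setminus E$, then there is a subsequence $(R^{n_i}(x))_i$ of $(R^n(x))_n$ such that $R^{n_i}(x)\to x$ weakly.
   Context: $S_Y$ denotes the unit sphere of $Y$ (for the norm of $X$ restricted to $Y$). If $X$ has a symmetric Schauder basis $(e_i)_{i=1}^\infty$, then there is an equivalent norm $\|\cdot\|$ on $X$ such that $\left\|\sum_{i=1}^\infty x_ie_i\right\|=\left\|\sum_{i=1}^\infty\lambda_ix_ie_{\pi(i)}\right\|$ whenever $\sum_i x_ie_i\in X$, $\pi$ is a permutation of $\mathbb{N}$ and the $\lambda_i$ are scalars with $|\lambda_i|=1$ for all $i$; such a norm is called symmetric. A subset $E$ of a Banach space is called symmetric if $\lambda x\in E$ whenever $x\in E$ and $\lambda$ is a scalar with $|\lambda|=1$. *)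

theory Defs
  imports "HOL-Analysis.Analysis"
begin

text \<open>The scalar fields: exactly the normed fields isometrically isomorphic to the real or to the
  complex numbers.\<close>

class real_or_complex = real_normed_field +
  assumes real_or_complex:
    "\<exists>\<phi> :: 'a \<Rightarrow> complex.
       (\<forall>x y. \<phi> (x + y) = \<phi> x + \<phi> y) \<and> (\<forall>x y. \<phi> (x * y) = \<phi> x * \<phi> y) \<and>
       (\<forall>r. \<phi> (r *\<^sub>R 1) = complex_of_real r) \<and> (\<forall>x. cmod (\<phi> x) = norm x) \<and>
       (range \<phi> = range complex_of_real \<or> range \<phi> = UNIV)"

instance real :: real_or_complex
  by standard (rule exI[of _ complex_of_real], simp)

instance complex :: real_or_complex
  by standard (rule exI[of _ id], auto simp: scaleR_conv_of_real)

text \<open>A Banach space over \<open>'k\<close>. The type class only provides the underlying real Banach space; the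
  action of \<open>'k\<close> is the parameter \<open>smul\<close>. For \<open>'k = real\<close> it is necessarily \<open>scaleR\<close>.\<close>

locale banach_over = vector_space smul
  for smul :: "'k::real_or_complex \<Rightarrow> 'a::banach \<Rightarrow> 'a" +
  assumes smul_of_real: "smul (of_real r) x = r *\<^sub>R x"
    and norm_smul: "norm (smul c x) = norm c * norm x"

definition infinite_dimensional :: "('k::field \<Rightarrow> 'a::ab_group_add \<Rightarrow> 'a) \<Rightarrow> bool" where
  "infinite_dimensional smul \<longleftrightarrow> \<not> (\<exists>B. finite B \<and> module.span smul B = UNIV)"

definition bounded_operator ::
  "('k::field \<Rightarrow> 'a::real_normed_vector \<Rightarrow> 'a) \<Rightarrow> ('k \<Rightarrow> 'b::real_normed_vector \<Rightarrow> 'b) \<Rightarrow> ('a \<Rightarrow> 'b) \<Rightarrow> bool"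
  where "bounded_operator smul smul' T \<longleftrightarrow> Vector_Spaces.linear smul smul' T \<and> bounded_linear T"

definition projection_onto ::
  "('k::field \<Rightarrow> 'a::real_normed_vector \<Rightarrow> 'a) \<Rightarrow> 'a set \<Rightarrow> ('a \<Rightarrow> 'a) \<Rightarrow> bool" where
  "projection_onto smul Y J \<longleftrightarrow> bounded_operator smul smul J \<and> J \<circ> J = J \<and> range J = Y"

definition weakly_converges ::
  "('k::real_normed_field \<Rightarrow> 'a::real_normed_vector \<Rightarrow> 'a) \<Rightarrow> (nat \<Rightarrow> 'a) \<Rightarrow> 'a \<Rightarrow> bool" where
  "weakly_converges smul u x \<longleftrightarrow>
     (\<forall>f :: 'a \<Rightarrow> 'k. bounded_operator smul (*) f \<longrightarrow> (\<lambda>n. f (u n)) \<longlonglongrightarrow> f x)"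

definition schauder_basis ::
  "('k \<Rightarrow> 'a::real_normed_vector \<Rightarrow> 'a) \<Rightarrow> (nat \<Rightarrow> 'a) \<Rightarrow> bool" where
  "schauder_basis smul e \<longleftrightarrow> (\<forall>x. \<exists>!a. (\<lambda>i. smul (a i) (e i)) sums x)"

definition equivalent_bases ::
  "('k \<Rightarrow> 'a::real_normed_vector \<Rightarrow> 'a) \<Rightarrow> (nat \<Rightarrow> 'a) \<Rightarrow> (nat \<Rightarrow> 'a) \<Rightarrow> bool" where
  "equivalent_bases smul e f \<longleftrightarrow> schauder_basis smul e \<and> schauder_basis smul f \<and>
     (\<forall>a. summable (\<lambda>i. smul (a i) (e i)) \<longleftrightarrow> summable (\<lambda>i. smul (a i) (f i)))"

text \<open>The definition of Lindenstrauss and Tzafriri: all permutations of the basis are equivalent.\<close>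

definition symmetric_basis ::
  "('k \<Rightarrow> 'a::real_normed_vector \<Rightarrow> 'a) \<Rightarrow> (nat \<Rightarrow> 'a) \<Rightarrow> bool" where
  "symmetric_basis smul e \<longleftrightarrow> schauder_basis smul e \<and>
     (\<forall>\<pi>. bij \<pi> \<longrightarrow> equivalent_bases smul (\<lambda>i. e (\<pi> i)) e)"

text \<open>The norm of \<open>'a\<close> is symmetric with respect to \<open>e\<close>. Convergence of the transformed series is
  part of the identity and must be stated, since \<open>suminf\<close> is total.\<close>

definition symmetric_norm ::
  "('k::real_normed_field \<Rightarrow> 'a::real_normed_vector \<Rightarrow> 'a) \<Rightarrow> (nat \<Rightarrow> 'a) \<Rightarrow> bool" where
  "symmetric_norm smul e \<longleftrightarrow>
     (\<forall>a \<pi> l. summable (\<lambda>i. smul (a i) (e i)) \<and> bij \<pi> \<and> (\<forall>i. norm (l i) = 1) \<longrightarrow>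
        summable (\<lambda>i. smul (l i * a i) (e (\<pi> i))) \<and>
        norm (\<Sum>i. smul (a i) (e i)) = norm (\<Sum>i. smul (l i * a i) (e (\<pi> i))))"

definition symmetric_set :: "('k::real_normed_field \<Rightarrow> 'a \<Rightarrow> 'a) \<Rightarrow> 'a set \<Rightarrow> bool" where
  "symmetric_set smul E \<longleftrightarrow> (\<forall>x\<in>E. \<forall>l. norm l = 1 \<longrightarrow> smul l x \<in> E)"

definition unit_sphere :: "'a::real_normed_vector set \<Rightarrow> 'a set" where
  "unit_sphere Y = {y \<in> Y. norm y = 1}"

end

theory Submission imports Defs begin

text \<open>The idea is to perturb the identity by infinitely many very slow plane rotations. Suppose that
\<open>(u\<^sub>k, w\<^sub>k; a\<^sub>k, b\<^sub>k)\<close> is a bounded biorthogonal system with \<open>u\<^sub>k, w\<^sub>k \<in> ker J\<close> and with functionals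
\<open>a\<^sub>k, b\<^sub>k\<close> that vanish on \<open>Y\<close>. Rotating the plane spanned by \<open>u\<^sub>k\<close> and \<open>w\<^sub>k\<close> by the angle
\<open>\<theta>\<^sub>k = 2 * pi / m\<^sub>k\<^sub>+\<^sub>1\<close>, where \<open>m\<^sub>k\<close> divides \<open>m\<^sub>k\<^sub>+\<^sub>1\<close> and \<open>m\<close> grows quickly, gives an operator whose
powers with the exponents \<open>m\<^sub>k\<close> tend to the identity pointwise. The point is that the coordinate
functionals of the planes can be tilted: a functional \<open>g\<^sub>k\<close> that factors through \<open>J\<close> annihilates all the
planes, so that \<open>a\<^sub>k + K\<^sub>k * g\<^sub>k\<close> can replace \<open>a\<^sub>k\<close> without destroying biorthogonality, for any number \<open>K\<^sub>k\<close>.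
For \<open>K\<^sub>k = m\<^sub>k\<^sub>+\<^sub>1 / m\<^sub>k\<close> the product \<open>K\<^sub>k * \<theta>\<^sub>k = 2 * pi / m\<^sub>k\<close> is still small, hence the operator \<open>R\<close> is
bounded; its effect on \<open>x\<close> is that of turning the huge vector \<open>K\<^sub>k * g\<^sub>k x * u\<^sub>k\<close> very slowly. While
\<open>m\<^sub>k \<le> 4 * n \<le> m\<^sub>k\<^sub>+\<^sub>1\<close> the \<open>w\<^sub>k\<close>-coordinate of \<open>R\<^sup>n x\<close> is at least of order \<open>\<bar>g\<^sub>k x\<bar>\<close>, up to a bounded
error, and the windows of consecutive \<open>k\<close> leave no gap; so \<open>R\<^sup>n x\<close> tends to infinity if \<open>\<bar>g\<^sub>k x\<bar>\<close> does.
On the other hand \<open>R\<^sup>n x - x\<close> for \<open>n = m\<^sub>k\<close> is at most of order \<open>\<bar>g\<^sub>k x\<bar>\<close> up to a null sequence; so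
\<open>R\<^sup>n x\<close> returns to \<open>x\<close>, even in norm, along a subsequence on which \<open>g\<^sub>k x\<close> tends to 0. This is
\<open>operator_from_block_rotations\<close>, where each \<open>k\<close> carries finitely many planes, so that a finite family of
functionals \<open>g\<^sub>k\<^sub>p\<close> takes the place of \<open>g\<^sub>k\<close>.

It remains to find \<open>g\<^sub>k\<close> that grow on \<open>E\<close> and have small values infinitely often at every other point
of the sphere. A family of linear functionals of \<open>y\<close> that vanishes exactly at the multiples of a point
\<open>z\<close> is given by the coordinates of the wedge product of \<open>y\<close> and \<open>z\<close>. For \<open>z\<close> outside of the
symmetric set \<open>E\<close> they are bounded away from 0 on \<open>E\<close>. Running through finer and finer finite nets
\<open>z\<^sub>k\<close> of larger and larger compact parts of the complement, with suitable factors, gives the sequence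
(\<open>escape_and_return_sequence\<close>).

For the biorthogonal system, let \<open>P\<close> be a bounded projection onto \<open>Y\<close> that annihilates all but finitely
many basis vectors \<open>e\<^sub>i\<close> (\<open>projection_killing_tail\<close>). Then the vectors \<open>e\<^sub>i - J e\<^sub>i\<close> lie in the kernel of \<open>J\<close>, the
functionals \<open>f\<^sub>i \<circ> (id - P)\<close>, with coordinate functionals \<open>f\<^sub>i\<close>, vanish on \<open>Y\<close>, and for the
indices \<open>i\<close> with \<open>P e\<^sub>i = 0\<close> they are biorthogonal, because the correction terms are annihilated. The
symmetric norm enters through the uniform bounds on \<open>e\<^sub>i\<close> and \<open>f\<^sub>i\<close>.\<close>

section \<open>Infinite sums of plane rotations\<close>

lemma abs_one_minus_cos_le: "\<bar>1 - cos t\<bar> \<le> \<bar>t :: real\<bar>"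
proof -
  have "\<bar>1 - cos t\<bar> = 2 * (\<bar>sin (t / 2)\<bar> * \<bar>sin (t / 2)\<bar>)"
    using cos_double_sin[of "t / 2"] by (simp add: power2_eq_square abs_mult)
  also have "\<dots> \<le> 2 * (1 * \<bar>t / 2\<bar>)"
    by (intro mult_left_mono mult_mono abs_sin_x_le_abs_x) auto
  finally show ?thesis by simp
qed

text \<open>An operator with \<open>B\<^sup>3 = - B\<close> generates rotations by Rodrigues' formula
\<open>exp (t * B) = id + sin t * B + (1 - cos t) * B\<^sup>2\<close>. Generators that annihilate one another commute, so
the operator \<open>R\<close> is the exponential of \<open>\<Sum>i. \<theta>\<^sub>i * B\<^sub>i\<close>, and its powers come from multiplying all angles by \<open>n\<close>.\<close>

lemma rotation_powers:
  fixes B :: "nat \<Rightarrow> 'a::banach \<Rightarrow>\<^sub>L 'a" and \<theta> :: "nat \<Rightarrow> real"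
  assumes cube: "\<And>i. B i o\<^sub>L B i o\<^sub>L B i = - B i"
    and orth: "\<And>i j. i \<noteq> j \<Longrightarrow> B i o\<^sub>L B j = 0"
    and summ: "summable (\<lambda>i. \<bar>\<theta> i\<bar> * (norm (B i) + norm (B i o\<^sub>L B i)))"
  shows "\<exists>R :: 'a \<Rightarrow>\<^sub>L 'a. \<forall>n x.
    (\<lambda>i. sin (real n * \<theta> i) *\<^sub>R B i x + (1 - cos (real n * \<theta> i)) *\<^sub>R B i (B i x))
      sums ((blinfun_apply R ^^ n) x - x)"
proof -
  define T where "T n i = sin (real n * \<theta> i) *\<^sub>R B i + (1 - cos (real n * \<theta> i)) *\<^sub>R (B i o\<^sub>L B i)"
    for n i
  have T_bound: "norm (T n i) \<le> real n * (\<bar>\<theta> i\<bar> * (norm (B i) + norm (B i o\<^sub>L B i)))" for n i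
  proof -
    let ?t = "real n * \<theta> i"
    have s: "\<bar>sin ?t\<bar> \<le> real n * \<bar>\<theta> i\<bar>"
      using abs_sin_x_le_abs_x[of ?t] by (simp add: abs_mult)
    have c: "\<bar>1 - cos ?t\<bar> \<le> real n * \<bar>\<theta> i\<bar>"
      using abs_one_minus_cos_le[of ?t] by (simp add: abs_mult)
    have "norm (T n i) \<le> \<bar>sin ?t\<bar> * norm (B i) + \<bar>1 - cos ?t\<bar> * norm (B i o\<^sub>L B i)"
      unfolding T_def by (rule order.trans[OF norm_triangle_ineq]) simp
    also have "\<dots> \<le> (real n * \<bar>\<theta> i\<bar>) * norm (B i) + (real n * \<bar>\<theta> i\<bar>) * norm (B i o\<^sub>L B i)"
      by (intro add_mono mult_right_mono s c) auto
    finally show ?thesis by (simp add: algebra_simps)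
  qed
  have T_summable: "summable (T n)" for n
    by (rule summable_comparison_test'[OF summable_mult[OF summ, of "real n"]]) (rule T_bound)
  define R where "R = id_blinfun + suminf (T 1)"
  have T_sums: "(\<lambda>i. T n i x) sums (suminf (T n) x)" for n x
    by (rule bounded_linear.sums[OF blinfun.bounded_linear_left summable_sums[OF T_summable]])
  have cubex: "B i (B i (B i x)) = - B i x" for i x
    using arg_cong[OF cube[of i], of "\<lambda>f. blinfun_apply f x"] by (simp add: blinfun.minus_left)
  have orthx: "i \<noteq> j \<Longrightarrow> B i (B j x) = 0" for i j x
    using arg_cong[OF orth[of i j], of "\<lambda>f. blinfun_apply f x"] by simp
  have T_apply: "T n i x = sin (real n * \<theta> i) *\<^sub>R B i x + (1 - cos (real n * \<theta> i)) *\<^sub>R B i (B i x)"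
    for n i x by (simp add: T_def blinfun.add_left blinfun.scaleR_left)
  have T_orth: "T m i (T n j x) = 0" if "i \<noteq> j" for m n i j x
    unfolding T_apply using that
    by (simp add: blinfun.add_right blinfun.scaleR_right orthx)
  \<comment> \<open>the addition theorems of sine and cosine, in one plane\<close>
  have T_Suc: "T (Suc n) i x = T n i x + T 1 i x + T 1 i (T n i x)" for n i x
  proof -
    have arg: "real (Suc n) * \<theta> i = \<theta> i + real n * \<theta> i" by (simp add: algebra_simps)
    show ?thesis
      unfolding T_apply arg sin_add cos_add
      by (simp add: blinfun.add_right blinfun.diff_right blinfun.minus_right blinfun.scaleR_right
          cubex algebra_simps)
  qed
  have step: "suminf (T (Suc n)) x = suminf (T n) x + suminf (T 1) (x + suminf (T n) x)" for n x
  proof -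
    let ?y = "suminf (T n) x"
    have "T 1 i ?y = T 1 i (T n i x)" for i
    proof -
      have "(\<lambda>j. T 1 i (T n j x)) sums T 1 i ?y"
        by (rule bounded_linear.sums[OF blinfun.bounded_linear_right T_sums])
      moreover have "(\<lambda>j. T 1 i (T n j x)) sums T 1 i (T n i x)"
        using sums_finite[of "{i}" "\<lambda>j. T 1 i (T n j x)"] T_orth[of i _ 1 n x] by auto
      ultimately show ?thesis by (rule sums_unique2)
    qed
    then have "T (Suc n) i x = T n i x + T 1 i (x + ?y)" for i
      unfolding T_Suc blinfun.add_right by (simp only: add.assoc)
    then have "(\<lambda>i. T (Suc n) i x) = (\<lambda>i. T n i x + T 1 i (x + ?y))" by (rule ext)
    with sums_add[OF T_sums[of n x] T_sums[of 1 "x + ?y"]]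
    have "(\<lambda>i. T (Suc n) i x) sums (?y + suminf (T 1) (x + ?y))" by metis
    with T_sums[of "Suc n" x] show ?thesis by (rule sums_unique2)
  qed
  have "T 0 = (\<lambda>_. 0)" by (simp add: T_def fun_eq_iff)
  then have zero: "suminf (T 0) = 0" by simp
  have power: "(blinfun_apply R ^^ n) x = x + suminf (T n) x" for n x
  proof (induction n)
    case 0 then show ?case by (simp add: zero)
  next
    case (Suc n)
    have "(blinfun_apply R ^^ Suc n) x = R (x + suminf (T n) x)" using Suc.IH by simp
    also have "\<dots> = x + suminf (T (Suc n)) x"
      unfolding step by (simp add: R_def blinfun.add_left)
    finally show ?case .
  qed
  show ?thesis
  proof (intro exI allI)
    show "(\<lambda>i. sin (real n * \<theta> i) *\<^sub>R B i x + (1 - cos (real n * \<theta> i)) *\<^sub>R B i (B i x))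
            sums ((blinfun_apply R ^^ n) x - x)" for n x
      using T_sums[of n x] unfolding T_apply power add_diff_cancel_left' .
  qed
qed

section \<open>Scaled nets that separate a closed set from its complement\<close>

text \<open>Let \<open>K s\<close> consist of the points that have distance at least \<open>1 / (s + 1)\<close> from all of \<open>E\<close>, as measured by \<open>\<Phi>\<close>.
These compact sets exhaust the complement of \<open>E\<close>. If \<open>z\<close> belongs to a finite net of \<open>K s\<close> of
fineness \<open>1 / (s + 1)\<^sup>3\<close>, the factor \<open>(s + 1)\<^sup>2\<close> lifts \<open>\<Phi> y z\<close> to at least \<open>s + 1\<close> for every \<open>y \<in> E\<close>, while
every \<open>y \<in> K s\<close> has such a net point with scaled value below \<open>1 / (s + 1)\<close>. The points of all nets are
then put into one sequence.\<close>

lemma escape_and_return_sequence: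
  fixes \<Phi> :: "'a::metric_space \<Rightarrow> 'a \<Rightarrow> real"
  assumes S: "compact S" and E: "closed E" "E \<subseteq> S" "E \<noteq> S"
    and cont: "continuous_on (S \<times> S) (\<lambda>(y, z). \<Phi> y z)"
    and diag: "\<And>z. z \<in> S \<Longrightarrow> \<Phi> z z = 0"
    and nonneg: "\<And>y z. 0 \<le> \<Phi> y z"
    and pos: "\<And>y z. y \<in> E \<Longrightarrow> z \<in> S - E \<Longrightarrow> 0 < \<Phi> y z"
  obtains z \<alpha> where "\<And>k::nat. z k \<in> S" "\<And>k. 0 \<le> \<alpha> k"
    "\<And>y. y \<in> E \<Longrightarrow> filterlim (\<lambda>k. \<alpha> k * \<Phi> y (z k)) at_top sequentially"
    "\<And>y. y \<in> S - E \<Longrightarrow> \<exists>r::nat \<Rightarrow> nat. strict_mono r \<and> (\<lambda>i. \<alpha> (r i) * \<Phi> y (z (r i))) \<longlonglongrightarrow> 0"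
proof -
  have cont1: "continuous_on S (\<lambda>y. \<Phi> y z)" if "z \<in> S" for z
  proof -
    have "continuous_on S (\<lambda>y. (y, z))" by (intro continuous_intros)
    from continuous_on_compose2[OF cont this] that show ?thesis by auto
  qed
  have cont2: "continuous_on S (\<Phi> y)" if "y \<in> S" for y
  proof -
    have "continuous_on S (\<lambda>z. (y, z))" by (intro continuous_intros)
    from continuous_on_compose2[OF cont this] that show ?thesis by auto
  qed
  have compE: "compact E"
    using S E compact_Int_closed[of S E] by (simp add: Int_absorb1)
  define K where "K s = {z \<in> S. \<forall>y\<in>E. 1 / real (Suc s) \<le> \<Phi> y z}" for s
  have K_compact: "compact (K s)" for s
  proof -
    have "K s = S \<inter> (\<Inter>y\<in>E. {z \<in> S. 1 / real (Suc s) \<le> \<Phi> y z})"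
      by (auto simp: K_def)
    moreover have "closed {z \<in> S. 1 / real (Suc s) \<le> \<Phi> y z}" if "y \<in> E" for y
    proof -
      have "{z \<in> S. 1 / real (Suc s) \<le> \<Phi> y z} = S \<inter> \<Phi> y -` {1 / real (Suc s)..}"
        by auto
      then show ?thesis
        using continuous_closed_preimage[OF cont2 compact_imp_closed[OF S]] that E by auto
    qed
    ultimately show ?thesis
      using compact_Int_closed[OF S closed_INT] by (metis (no_types, lifting))
  qed
  have K_mono: "K s \<subseteq> K t" if "s \<le> t" for s t
  proof -
    have "1 / real (Suc t) \<le> 1 / real (Suc s)" using that by (intro frac_le) auto
    then show ?thesis unfolding K_def using order.trans by blast
  qed
  have K_exhausts: "\<exists>s. z \<in> K s" if z: "z \<in> S - E" for z
  proof (cases "E = {}")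
    case True then show ?thesis using z by (auto simp: K_def)
  next
    case False
    have "continuous_on E (\<lambda>y. \<Phi> y z)"
      using cont1 z E(2) continuous_on_subset by blast
    then obtain y0 where y0: "y0 \<in> E" "\<And>y. y \<in> E \<Longrightarrow> \<Phi> y0 z \<le> \<Phi> y z"
      using continuous_attains_inf[OF compE False] by blast
    from pos[OF y0(1) z] obtain s where "1 / real (Suc s) < \<Phi> y0 z"
      using reals_Archimedean by (auto simp: inverse_eq_divide)
    then have "z \<in> K s" using z y0(2) by (force simp: K_def)
    then show ?thesis ..
  qed
  obtain s0 where s0: "K s0 \<noteq> {}" using K_exhausts E by blast
  have net: "\<exists>P. finite P \<and> P \<subseteq> K s \<and> (\<forall>y\<in>K s. \<exists>z\<in>P. \<Phi> y z < 1 / real (Suc s) ^ 3)" for s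
  proof -
    define U where "U z = {y \<in> S. \<Phi> y z < 1 / real (Suc s) ^ 3}" for z
    have op: "openin (top_of_set S) (U z)" if "z \<in> K s" for z
    proof -
      have "U z = S \<inter> (\<lambda>y. \<Phi> y z) -` {..<1 / real (Suc s) ^ 3}" by (auto simp: U_def)
      then show ?thesis
        using continuous_openin_preimage_gen[OF cont1, of z "{..<1 / real (Suc s) ^ 3}"] that
        by (auto simp: K_def)
    qed
    then obtain V where V: "\<And>z. z \<in> K s \<Longrightarrow> open (V z) \<and> U z = S \<inter> V z"
      unfolding openin_open by metis
    have "z \<in> V z" if "z \<in> K s" for z
      using V[OF that] diag that by (auto simp: K_def U_def)
    then have "K s \<subseteq> (\<Union>z\<in>K s. V z)" by blast
    then obtain P where P: "P \<subseteq> K s" "finite P" "K s \<subseteq> (\<Union>z\<in>P. V z)"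
      using compactE_image[OF K_compact[of s], of "K s" V] V by blast
    show ?thesis
    proof (intro exI conjI ballI)
      fix y assume y: "y \<in> K s"
      then obtain z where "z \<in> P" "y \<in> V z" using P by auto
      then show "\<exists>z\<in>P. \<Phi> y z < 1 / real (Suc s) ^ 3"
        using V[of z] P y by (auto simp: K_def U_def)
    qed (use P in auto)
  qed
  then obtain P where P: "\<And>s. finite (P s)" "\<And>s. P s \<subseteq> K s"
    "\<And>s y. y \<in> K s \<Longrightarrow> \<exists>z\<in>P s. \<Phi> y z < 1 / real (Suc s) ^ 3" by metis
  \<comment> \<open>As an enumeration of \<open>W\<close> is injective and every net is finite, the stage of its
    \<open>k\<close>-th member tends to infinity with \<open>k\<close>. Stages from \<open>s0\<close> on have nonempty nets,
    so that \<open>W\<close> is infinite.\<close>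
  define W where "W = (SIGMA s:{s0..}. P s)"
  have P_ne: "P s \<noteq> {}" if "s \<ge> s0" for s
    using P(3) s0 K_mono[OF that] by fastforce
  have "fst ` W = {s0..}" using P_ne by (force simp: W_def image_iff)
  then have "infinite W" using finite_imageI[of W fst] infinite_Ici[of s0] by auto
  moreover have "countable W"
    unfolding W_def using P(1) countable_finite by (intro countable_SIGMA) auto
  ultimately have bij: "bij_betw (from_nat_into W) UNIV W"
    by (intro bij_betw_from_nat_into)
  define g where "g = from_nat_into W"
  define stage where "stage k = fst (g k)" for k
  define z where "z k = snd (g k)" for k
  have gW: "g k \<in> W" for k using bij by (auto simp: g_def bij_betw_def)
  have zP: "z k \<in> P (stage k)" for k
    using gW[of k] by (auto simp: W_def z_def stage_def)
  have stage_large: "\<forall>\<^sub>F k in sequentially. s \<le> stage k" for s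
  proof -
    have "{k. \<not> s \<le> stage k} \<subseteq> g -` (SIGMA t:{..<s}. P t)"
    proof
      fix k assume "k \<in> {k. \<not> s \<le> stage k}"
      then show "k \<in> g -` (SIGMA t:{..<s}. P t)"
        using gW[of k] by (auto simp: W_def stage_def)
    qed
    moreover have "finite (g -` (SIGMA t:{..<s}. P t))"
      using bij P(1) by (intro finite_vimageI) (auto simp: g_def bij_betw_def)
    ultimately have "finite {k. \<not> s \<le> stage k}" using finite_subset by blast
    then show ?thesis by (simp add: eventually_cofinite flip: cofinite_eq_sequentially)
  qed
  define \<alpha> where "\<alpha> k = real (Suc (stage k)) ^ 2" for k
  show ?thesis
  proof (rule that)
    show "z k \<in> S" for k using zP[of k] P(2)[of "stage k"] by (auto simp: K_def)
    show "0 \<le> \<alpha> k" for k by (simp add: \<alpha>_def)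
  next
    fix y assume y: "y \<in> E"
    have low: "real (Suc (stage k)) \<le> \<alpha> k * \<Phi> y (z k)" for k
    proof -
      have "1 / real (Suc (stage k)) \<le> \<Phi> y (z k)"
        using zP[of k] P(2)[of "stage k"] y by (auto simp: K_def)
      then have "\<alpha> k * (1 / real (Suc (stage k))) \<le> \<alpha> k * \<Phi> y (z k)"
        by (intro mult_left_mono) (auto simp: \<alpha>_def)
      then show ?thesis by (simp add: \<alpha>_def power2_eq_square)
    qed
    show "filterlim (\<lambda>k. \<alpha> k * \<Phi> y (z k)) at_top sequentially"
      unfolding filterlim_at_top
    proof
      fix M :: real
      obtain s :: nat where "M \<le> real s" using real_arch_simple by blast
      from stage_large[of s] show "\<forall>\<^sub>F k in sequentially. M \<le> \<alpha> k * \<Phi> y (z k)"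
      proof eventually_elim
        case (elim k)
        then have "M \<le> real (Suc (stage k))" using \<open>M \<le> real s\<close> by linarith
        then show ?case using low by (rule order.trans)
      qed
    qed
  next
    fix y assume y: "y \<in> S - E"
    obtain s1 where s1: "y \<in> K s1" using K_exhausts y by blast
    have small: "\<exists>k>N. \<alpha> k * \<Phi> y (z k) < 1 / real (Suc n)" for N n
    proof -
      \<comment> \<open>a stage beyond all those met up to \<open>N\<close> forces an index beyond \<open>N\<close>\<close>
      define s where "s = Max ({s0, s1, n} \<union> stage ` {..N}) + 1"
      have ge: "t < s" if "t \<in> {s0, s1, n} \<union> stage ` {..N}" for t
        using Max_ge[OF _ that] by (simp add: s_def)
      have "y \<in> K s" using K_mono[of s1 s] s1 ge[of s1] by auto
      then obtain p where p: "p \<in> P s" "\<Phi> y p < 1 / real (Suc s) ^ 3" using P(3) by blast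
      have "(s, p) \<in> W" using p(1) ge[of s0] by (auto simp: W_def)
      then obtain k where k: "g k = (s, p)" using bij by (metis g_def bij_betw_def imageE)
      have "k > N"
      proof (rule ccontr)
        assume "\<not> k > N"
        then have "stage k < s" by (intro ge) auto
        then show False by (simp add: stage_def k)
      qed
      moreover have "\<alpha> k * \<Phi> y (z k) < 1 / real (Suc n)"
      proof -
        have "\<alpha> k * \<Phi> y (z k) < real (Suc s) ^ 2 * (1 / real (Suc s) ^ 3)"
          unfolding \<alpha>_def stage_def z_def k fst_conv snd_conv
          by (intro mult_strict_left_mono p(2)) simp
        also have "\<dots> = 1 / real (Suc s)"
          by (simp add: power2_eq_square power3_eq_cube del: of_nat_Suc)
        also have "\<dots> \<le> 1 / real (Suc n)" using ge[of n] by (intro frac_le) auto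
        finally show ?thesis .
      qed
      ultimately show ?thesis by blast
    qed
    have "\<exists>r. \<forall>n. (\<alpha> (r n) * \<Phi> y (z (r n)) < 1 / real (Suc n)) \<and> (r n::nat) < r (Suc n)"
    proof (rule dependent_nat_choice)
      show "\<exists>k. \<alpha> k * \<Phi> y (z k) < 1 / real (Suc 0)" using small by blast
      show "\<exists>k'. \<alpha> k' * \<Phi> y (z k') < 1 / real (Suc (Suc n)) \<and> k < k'" for k n
        using small by blast
    qed
    then obtain r :: "nat \<Rightarrow> nat" where r: "\<And>n. \<alpha> (r n) * \<Phi> y (z (r n)) < 1 / real (Suc n)"
      "\<And>n. r n < r (Suc n)" by blast
    have "(\<lambda>i. \<alpha> (r i) * \<Phi> y (z (r i))) \<longlonglongrightarrow> 0"
    proof (rule real_tendsto_sandwich)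
      show "\<forall>\<^sub>F n in sequentially. 0 \<le> \<alpha> (r n) * \<Phi> y (z (r n))"
        using nonneg by (simp add: \<alpha>_def)
      show "\<forall>\<^sub>F n in sequentially. \<alpha> (r n) * \<Phi> y (z (r n)) \<le> 1 / real (Suc n)"
        using r(1) by (intro always_eventually allI less_imp_le)
      show "(\<lambda>n. 1 / real (Suc n)) \<longlonglongrightarrow> 0" by (rule LIMSEQ_Suc[OF lim_1_over_n])
      show "(\<lambda>n. 0 :: real) \<longlonglongrightarrow> 0" by (rule tendsto_const)
    qed
    then show "\<exists>r. strict_mono r \<and> (\<lambda>i. \<alpha> (r i) * \<Phi> y (z (r i))) \<longlonglongrightarrow> 0"
      using r(2) by (auto simp: strict_mono_Suc_iff)
  qed
qed

section \<open>Linear maps and compactness over the scalar field\<close>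

text \<open>The isometry of the scalars onto the real line or the complex plane carries over compactness.\<close>

lemma compact_scalar_cball: "compact (cball (0 :: 'k::real_or_complex) r)"
proof -
  obtain \<phi> :: "'k \<Rightarrow> complex" where \<phi>: "\<And>x y. \<phi> (x + y) = \<phi> x + \<phi> y" "\<And>x. cmod (\<phi> x) = norm x"
    "range \<phi> = range complex_of_real \<or> range \<phi> = UNIV"
    using real_or_complex[where 'a = 'k] by blast
  have "\<phi> (x - y) = \<phi> x - \<phi> y" for x y using \<phi>(1)[of "x - y" y] by simp
  then have iso: "dist (\<phi> x) (\<phi> y) = dist x y" for x y by (metis \<phi>(2) dist_norm)
  have inj: "inj \<phi>" by (rule injI) (metis iso dist_eq_0_iff)
  have "closed (range complex_of_real)" using closed_complex_Reals by (simp add: Reals_def)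
  then have "closed (range \<phi>)" using \<phi>(3) by auto
  moreover have "\<phi> ` cball 0 r = cball 0 r \<inter> range \<phi>"
    using \<phi>(2) by (auto simp: dist_norm)
  ultimately have comp: "compact (\<phi> ` cball 0 r)" by (simp add: compact_Int_closed)
  have "continuous_on (range \<phi>) (inv \<phi>)"
  proof (rule continuous_onI)
    fix w \<epsilon> :: real and v assume "v \<in> range \<phi>" and "0 < (\<epsilon>::real)"
    then show "\<exists>\<delta>>0. \<forall>w\<in>range \<phi>. dist w v < \<delta> \<longrightarrow> dist (inv \<phi> w) (inv \<phi> v) \<le> \<epsilon>"
      by (intro exI[of _ \<epsilon>]) (auto simp: inj iso)
  qed
  then have "compact (inv \<phi> ` \<phi> ` cball 0 r)"
    using compact_continuous_image[OF continuous_on_subset comp] by blast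
  then show ?thesis by (simp add: image_image inj)
qed

context banach_over
begin

lemma bounded_linear_smul: "bounded_linear (smul c)"
proof (rule bounded_linear_intro)
  show "smul c (r *\<^sub>R x) = r *\<^sub>R smul c x" for r x
    by (simp add: smul_of_real[symmetric] mult.commute)
  show "norm (smul c x) \<le> norm x * norm c" for x by (simp add: norm_smul)
qed (rule scale_right_distrib)

lemma bounded_linear_smul_left: "bounded_linear (\<lambda>t. smul t x)"
proof (rule bounded_linear_intro)
  show "smul (r *\<^sub>R t) x = r *\<^sub>R smul t x" for r t
    by (simp add: smul_of_real[symmetric] scaleR_conv_of_real)
  show "norm (smul t x) \<le> norm t * norm x" for t by (simp add: norm_smul)
qed (rule scale_left_distrib)

lemma linear_smulI:
  assumes "\<And>x y. T (x + y) = T x + T y" "\<And>t x. T (smul t x) = smul t (T x)"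
  shows "Vector_Spaces.linear smul smul T"
  using assms vector_space_axioms by (auto simp: Vector_Spaces.linear_iff)

lemma linear_functionalI:
  assumes "\<And>x y. f (x + y) = f x + f y" "\<And>t x. f (smul t x) = t * f x"
  shows "Vector_Spaces.linear smul (*) f"
proof -
  have "vector_space ((*) :: 'k \<Rightarrow> 'k \<Rightarrow> 'k)"
    by unfold_locales (simp_all add: algebra_simps)
  then show ?thesis using assms vector_space_axioms by (auto simp: Vector_Spaces.linear_iff)
qed

lemma bounded_operatorI:
  assumes "Vector_Spaces.linear smul smul T" "\<And>x. norm (T x) \<le> C * norm x"
  shows "bounded_operator smul smul T"
proof -
  have lin: "T (x + y) = T x + T y" "T (smul t x) = smul t (T x)" for x y t
    using assms(1) by (auto simp: Vector_Spaces.linear_iff)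
  have "bounded_linear T"
  proof (rule bounded_linear_intro)
    show "T (r *\<^sub>R x) = r *\<^sub>R T x" for r x by (metis lin(2) smul_of_real)
    show "norm (T x) \<le> norm x * C" for x using assms(2)[of x] by (simp add: mult.commute)
  qed (rule lin)
  then show ?thesis using assms(1) by (simp add: bounded_operator_def)
qed

lemma compact_bounded_combinations:
  "compact {\<Sum>i<(N::nat). smul (t i) (v i) | t. \<forall>i<N. norm (t i) \<le> r}"
proof (induction N)
  case 0
  then show ?case by simp
next
  case (Suc N)
  let ?A = "{\<Sum>i<N. smul (t i) (v i) | t. \<forall>i<N. norm (t i) \<le> r}"
  let ?C = "(\<lambda>s. smul s (v N)) ` cball 0 r"
  have "compact ?C"
    by (intro compact_continuous_image compact_scalar_cball
        linear_continuous_on bounded_linear_smul_left)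
  with Suc have "compact {x + y | x y. x \<in> ?A \<and> y \<in> ?C}" by (rule compact_sums)
  also have "{x + y | x y. x \<in> ?A \<and> y \<in> ?C} =
      {\<Sum>i<Suc N. smul (t i) (v i) | t. \<forall>i<Suc N. norm (t i) \<le> r}" (is "?L = ?R")
  proof
    show "?L \<subseteq> ?R"
    proof
      fix z assume "z \<in> ?L"
      then obtain t s where "z = (\<Sum>i<N. smul (t i) (v i)) + smul s (v N)"
        "\<forall>i<N. norm (t i) \<le> r" "norm s \<le> r" by auto
      then show "z \<in> ?R" by (intro CollectI exI[of _ "t(N := s)"]) (auto simp: less_Suc_eq)
    qed
    show "?R \<subseteq> ?L" by (fastforce simp: less_Suc_eq)
  qed
  finally show ?case .
qed

text \<open>The sphere is a closed subset of a set of linear combinations with bounded coefficients; being the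
set of fixed points of a bounded projection is what makes \<open>Y\<close> closed.\<close>

lemma compact_unit_sphere_of_projection:
  assumes P: "bounded_linear P" "\<And>y. y \<in> Y \<longleftrightarrow> P y = y"
    and rep: "\<And>y. y \<in> Y \<Longrightarrow> y = (\<Sum>i<(N::nat). smul (f i y) (v i))"
    and bound: "\<And>i x. norm (f i x) \<le> C * norm x"
  shows "compact (unit_sphere Y)"
proof -
  have "unit_sphere Y = {y. P y = y} \<inter> {y. norm y = 1}"
    using P(2) by (auto simp: unit_sphere_def)
  moreover have "closed {y. P y = y}" "closed {y :: 'a. norm y = 1}"
    by (intro closed_Collect_eq continuous_intros linear_continuous_on P)+
  ultimately have "closed (unit_sphere Y)" by (simp only: closed_Int)
  moreover have "unit_sphere Y \<subseteq> {\<Sum>i<N. smul (t i) (v i) | t. \<forall>i<N. norm (t i) \<le> C}"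
  proof
    fix y assume y: "y \<in> unit_sphere Y"
    then have "norm (f i y) \<le> C" for i using bound[of i y] by (simp add: unit_sphere_def)
    then show "y \<in> {\<Sum>i<N. smul (t i) (v i) | t. \<forall>i<N. norm (t i) \<le> C}"
      using rep[of y] y by (intro CollectI exI[of _ "\<lambda>i. f i y"]) (simp add: unit_sphere_def)
  qed
  ultimately show ?thesis
    using compact_Int_closed[OF compact_bounded_combinations, of "unit_sphere Y" v N C]
    by (simp only: Int_absorb1)
qed

section \<open>Coordinates with respect to the basis\<close>

text \<open>The symmetric norm makes the continuity of the coordinate functionals elementary: changing all signs
except that of the \<open>i\<close>-th coordinate and adding the result to \<open>x\<close> leaves twice the \<open>i\<close>-th term, which
therefore has norm at most twice that of \<open>x\<close>. Transpositions show that all basis vectors have equal norm.\<close>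

lemma coordinate_functionals:
  assumes "schauder_basis smul e" "symmetric_norm smul e"
  obtains f c where "0 < (c::real)"
    "\<And>i. Vector_Spaces.linear smul (*) (f i)"
    "\<And>i l. f i (e l) = (if i = l then 1 else 0)"
    "\<And>i x. norm (f i x) * c \<le> norm x"
    "\<And>i::nat. norm (e i) = c"
    "\<And>x. (\<lambda>i. smul (f i x) (e i)) sums x"
proof -
  define f where "f i x = (THE a. (\<lambda>i. smul (a i) (e i)) sums x) i" for i x
  have uniq: "\<exists>!a. (\<lambda>i. smul (a i) (e i)) sums x" for x
    using assms(1) by (simp add: schauder_basis_def)
  have f_sums: "(\<lambda>i. smul (f i x) (e i)) sums x" for x
    unfolding f_def using theI'[OF uniq[of x]] by simp
  have f_eq: "f i x = a i" if "(\<lambda>i. smul (a i) (e i)) sums x" for a x i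
    unfolding f_def by (rule arg_cong[of _ a "\<lambda>a. a i"], rule the1_equality[OF uniq]) (rule that)
  have f_add: "f i (x + y) = f i x + f i y" for i x y
    using f_eq[of "\<lambda>i. f i x + f i y" "x + y" i] sums_add[OF f_sums[of x] f_sums[of y]]
    by (simp add: scale_left_distrib)
  have f_scale: "f i (smul t x) = t * f i x" for i t x
    using f_eq[of "\<lambda>i. t * f i x" "smul t x" i]
      bounded_linear.sums[OF bounded_linear_smul[of t] f_sums[of x]] by simp
  have delta_sums: "(\<lambda>j. smul (if j = i then s else 0) (v j)) sums smul s (v i)" for s i and v :: "nat \<Rightarrow> 'a"
    using sums_single[of i "\<lambda>j. smul s (v j)"] by (simp add: if_distrib[of "\<lambda>t. smul t _"] cong: if_cong)
  have f_e: "f i (e l) = (if i = l then 1 else 0)" for i l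
    using f_eq[OF delta_sums[of l 1 e, unfolded scale_one], of i] by simp
  have flip: "norm (f i x) * norm (e i) \<le> norm x" for i x
  proof -
    define l where "l j = (if j = i then 1 else - 1 :: 'k)" for j
    have sm: "summable (\<lambda>j. smul (f j x) (e j))" and x: "(\<Sum>j. smul (f j x) (e j)) = x"
      using f_sums[of x] by (auto simp: sums_iff)
    have "summable (\<lambda>j. smul (f j x) (e j)) \<and> bij (\<lambda>j::nat. j) \<and> (\<forall>j. norm (l j) = 1)"
      using sm bij_id by (auto simp: l_def id_def)
    note flipped = assms(2)[unfolded symmetric_norm_def, rule_format, OF this, unfolded x]
    then have sm': "summable (\<lambda>j. smul (l j * f j x) (e j))"
      and n: "norm (\<Sum>j. smul (l j * f j x) (e j)) = norm x" by simp_all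
    let ?x' = "\<Sum>j. smul (l j * f j x) (e j)"
    have "(\<lambda>j. smul (f j x) (e j) + smul (l j * f j x) (e j)) sums (x + ?x')"
      using sums_add[OF f_sums summable_sums[OF sm']] .
    moreover have "smul (f j x) (e j) + smul (l j * f j x) (e j) = smul (if j = i then 2 * f i x else 0) (e j)" for j
      by (simp add: l_def scale_left_distrib[symmetric])
    ultimately have "x + ?x' = smul (2 * f i x) (e i)"
      using delta_sums[of i "2 * f i x" e] by (simp add: sums_unique2)
    then have "norm (smul (2 * f i x) (e i)) \<le> 2 * norm x"
      using norm_triangle_ineq[of x ?x'] n by simp
    then show ?thesis by (simp add: norm_smul norm_mult)
  qed
  have same_norm: "norm (e i) = norm (e 0)" for i
  proof -
    let ?a = "\<lambda>j. if j = i then 1 else 0 :: 'k"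
    have a: "(\<lambda>j. smul (?a j) (e j)) sums e i"
      using delta_sums[of i 1 e] by simp
    have a': "(\<lambda>j. smul (1 * ?a j) (e (Transposition.transpose i 0 j))) sums e 0"
      using delta_sums[of i 1 "\<lambda>j. e (Transposition.transpose i 0 j)"] by simp
    have "norm (\<Sum>j. smul (?a j) (e j)) = norm (\<Sum>j. smul (1 * ?a j) (e (Transposition.transpose i 0 j)))"
      using assms(2)[unfolded symmetric_norm_def, rule_format, of ?a "Transposition.transpose i 0" "\<lambda>_. 1"]
        sums_summable[OF a] by simp
    then show ?thesis using a a' by (simp add: sums_iff)
  qed
  have "e 0 \<noteq> 0"
    using f_e[of 0 0] f_scale[of 0 0 0] by auto
  moreover have "norm (f i x) * norm (e 0) \<le> norm x" for i x
    using flip[of i x] same_norm[of i] by simp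
  ultimately show ?thesis
    using f_add f_scale f_e same_norm f_sums
    by (intro that[of "norm (e 0)" f] linear_functionalI) auto
qed


text \<open>The projection is built by adding one vector \<open>b\<close> at a time. If \<open>b' = b - P b\<close> is not 0, some
coordinate functional \<open>f i\<close> does not vanish at \<open>b'\<close>. The normalised functional \<open>f i \<circ> (id - P)\<close> is 0 on
the span reached so far and 1 at \<open>b\<close>, and \<open>e i\<close> is the only new basis vector that it does not annihilate.\<close>

lemma projection_killing_tail:
  assumes "0 < (c::real)"
    and f_lin: "\<And>i. Vector_Spaces.linear smul (*) (f i)"
    and f_e: "\<And>i l. f i (e l) = (if i = l then 1 else 0)"
    and f_bound: "\<And>i x. norm (f i x) * c \<le> norm x"
    and f_sums: "\<And>x. (\<lambda>i::nat. smul (f i x) (e i)) sums x"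
    and "finite B"
  obtains P N where "bounded_operator smul smul P"
    "\<And>l. N \<le> l \<Longrightarrow> P (e l) = 0" "\<And>x. P x \<in> span B" "\<And>y. y \<in> span B \<Longrightarrow> P y = y"
proof -
  have "\<exists>P N. bounded_operator smul smul P \<and> (\<forall>l\<ge>N. P (e l) = 0) \<and> (\<forall>x. P x \<in> span B) \<and>
          (\<forall>y\<in>span B. P y = y)"
    using \<open>finite B\<close>
  proof (induction B)
    case empty
    have "bounded_operator smul smul (\<lambda>x. 0)"
      by (rule bounded_operatorI[of _ 0], rule linear_smulI) auto
    then show ?case by (intro exI[of _ "\<lambda>x. 0"]) auto
  next
    case (insert b B)
    then obtain P N where P: "bounded_operator smul smul P" "\<And>l. N \<le> l \<Longrightarrow> P (e l) = 0"
      "\<And>x. P x \<in> span B" "\<And>y. y \<in> span B \<Longrightarrow> P y = y" by blast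
    have P_lin: "Vector_Spaces.linear smul smul P" and P_bl: "bounded_linear P"
      using P(1) by (auto simp: bounded_operator_def)
    interpret P: Vector_Spaces.linear smul smul P by (rule P_lin)
    have PP: "P (P x) = P x" for x using P(3,4) by blast
    define b' where "b' = b - P b"
    have Pb': "P b' = 0" by (simp add: b'_def P.diff PP)
    have in_span: "y \<in> span (insert b B) \<longleftrightarrow> (\<exists>t. y - smul t b' \<in> span B)" for y
    proof -
      have "smul t (P b) \<in> span B" for t using P(3) span_scale by blast
      moreover have "y - smul t b' = (y - smul t b) + smul t (P b)" for t
        by (simp add: b'_def scale_right_diff_distrib)
      ultimately have "y - smul t b' \<in> span B \<longleftrightarrow> y - smul t b \<in> span B" for t
        by (metis add_diff_cancel_right' span_add span_diff)
      then show ?thesis by (simp add: span_breakdown_eq)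
    qed
    show ?case
    proof (cases "b' = 0")
      case True
      then have "span (insert b B) = span B" using in_span by auto
      then show ?thesis using P by (intro exI[of _ P] exI[of _ N]) auto
    next
      case False
      then obtain i where i: "f i b' \<noteq> 0"
        using f_sums[of b'] sums_unique2[of "\<lambda>i. 0" b' 0] by fastforce
      interpret f: Vector_Spaces.linear smul "(*)" "f i" by (rule f_lin)
      define \<phi> where "\<phi> x = f i (x - P x) / f i b'" for x
      obtain K where K: "\<And>x. norm (P x) \<le> norm x * K" "K \<ge> 0"
        using bounded_linear.nonneg_bounded[OF P_bl] by blast
      have \<phi>_add: "\<phi> (x + y) = \<phi> x + \<phi> y" for x y
        by (simp add: \<phi>_def P.add f.add f.diff add_divide_distrib diff_divide_distrib)
      have \<phi>_scale: "\<phi> (smul t x) = t * \<phi> x" for t x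
        by (simp add: \<phi>_def P.scale f.scale f.diff right_diff_distrib)
      have \<phi>_bound: "norm (\<phi> x) \<le> (1 + K) / (c * norm (f i b')) * norm x" for x
      proof -
        have "norm (f i (x - P x)) * c \<le> norm x + norm x * K"
          using f_bound[of i "x - P x"] norm_triangle_ineq4[of x "P x"] K(1)[of x] by linarith
        then show ?thesis using \<open>0 < c\<close> i
          by (simp add: \<phi>_def norm_divide field_simps)
      qed
      define P' where "P' x = P x + smul (\<phi> x) b'" for x
      have lin: "Vector_Spaces.linear smul smul P'"
        by (rule linear_smulI) (simp_all add: P'_def P.add P.scale \<phi>_add \<phi>_scale scale_left_distrib
            scale_right_distrib add_ac)
      have "norm (P' x) \<le> (K + (1 + K) / (c * norm (f i b')) * norm b') * norm x" for x
      proof -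
        have "norm (P' x) \<le> norm (P x) + norm (\<phi> x) * norm b'"
          unfolding P'_def using norm_triangle_ineq[of "P x"] by (metis norm_smul)
        also have "\<dots> \<le> norm x * K + (1 + K) / (c * norm (f i b')) * norm x * norm b'"
          by (intro add_mono K mult_right_mono \<phi>_bound) auto
        finally show ?thesis by (simp add: algebra_simps)
      qed
      then have "bounded_operator smul smul P'" by (rule bounded_operatorI[OF lin])
      moreover have "P' (e l) = 0" if "max N (Suc i) \<le> l" for l
        using that P(2)[of l] f_e[of i l] by (simp add: P'_def \<phi>_def)
      moreover have "P' x \<in> span (insert b B)" for x
        unfolding in_span P'_def using P(3)[of x] by (intro exI[of _ "\<phi> x"]) simp
      moreover have "P' y = y" if "y \<in> span (insert b B)" for y
      proof -
        obtain t where t: "y - smul t b' \<in> span B" using \<open>y \<in> _\<close> in_span by blast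
        then have "P (y - smul t b') = y - smul t b'" by (rule P(4))
        then have "P y = y - smul t b'" by (simp add: P.diff P.scale Pb')
        then have "\<phi> y = t" using i by (simp add: \<phi>_def f.scale)
        then show ?thesis using \<open>P y = _\<close> by (simp add: P'_def)
      qed
      ultimately show ?thesis by blast
    qed
  qed
  then show ?thesis using that by blast
qed

end

section \<open>Escape and return from slow rotations\<close>

text \<open>Divisibility makes the rotations with a short period disappear at time \<open>m k\<close>; the growth condition
makes those with a long period negligible, even after weighting with \<open>\<gamma>\<close>.\<close>

lemma fast_divisibility_chain:
  fixes \<gamma> :: "nat \<Rightarrow> real"
  assumes "\<And>k. 0 \<le> \<gamma> k"
  obtains m :: "nat \<Rightarrow> nat" where "\<And>k. 0 < m k" "\<And>j k. j \<le> k \<Longrightarrow> m j dvd m k"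
    "\<And>k. (\<gamma> k + 1) * 4 ^ k \<le> m k" "\<And>j k. j < k \<Longrightarrow> real (m j) * ((\<gamma> k + 1) * 4 ^ k) \<le> m k"
proof -
  define M where "M k = nat \<lceil>(\<gamma> k + 1) * 4 ^ k\<rceil>" for k
  define m where "m k = (\<Prod>i\<le>k. M i)" for k
  have M_ge: "(\<gamma> k + 1) * 4 ^ k \<le> M k" for k by (simp add: M_def real_nat_ceiling_ge)
  have M_pos: "0 < M k" for k
  proof -
    have "0 < (\<gamma> k + 1) * 4 ^ k" using assms[of k] by (intro mult_pos_pos) auto
    with M_ge[of k] show ?thesis by linarith
  qed
  have m_pos: "0 < m k" for k using M_pos by (simp add: m_def)
  have dvd: "m j dvd m k" if "j \<le> k" for j k
    unfolding m_def by (rule prod_dvd_prod_subset) (use that in auto)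
  have less: "real (m j) * ((\<gamma> k + 1) * 4 ^ k) \<le> m k" if "j < k" for j k
  proof -
    obtain i where i: "k = Suc i" "j \<le> i" using \<open>j < k\<close> by (cases k) auto
    have "m j \<le> m i" using dvd[OF i(2)] m_pos by (auto intro: dvd_imp_le)
    then have "real (m j) * ((\<gamma> k + 1) * 4 ^ k) \<le> real (m i) * real (M k)"
      using M_ge[of k] assms[of k] by (intro mult_mono) auto
    then show ?thesis by (simp add: m_def i)
  qed
  have "(\<gamma> k + 1) * 4 ^ k \<le> m k" for k
  proof (cases k)
    case 0
    then show ?thesis using M_ge[of 0] by (simp add: m_def)
  next
    case (Suc i)
    have "1 * ((\<gamma> k + 1) * 4 ^ k) \<le> real (m i) * ((\<gamma> k + 1) * 4 ^ k)"
      using m_pos[of i] assms[of k] by (intro mult_right_mono) auto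
    also have "\<dots> \<le> m k" using less[of i k] Suc by simp
    finally show ?thesis by simp
  qed
  then show ?thesis using that m_pos dvd less by blast
qed

lemma sin_ge_half:
  assumes "0 \<le> t" "t \<le> pi / 2" shows "t / 2 \<le> sin (t::real)"
proof -
  have "\<bar>sin t - t\<bar> \<le> t ^ 3 / 6"
    using Maclaurin_sin_bound[of t 3] assms
    by (simp add: eval_nat_numeral sin_coeff_def)
  moreover have "t ^ 3 / 6 \<le> t / 2"
  proof -
    have "t \<le> 1.7" using assms(2) pi_less_4 pi_approx(2) by simp
    then have "t * t \<le> 1.7 * 1.7" using assms(1) by (intro mult_mono) auto
    then have "t * (t * t) \<le> t * 3" using assms(1) by (intro mult_left_mono) auto
    then show ?thesis by (simp add: power3_eq_cube mult.assoc)
  qed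
  ultimately show ?thesis by linarith
qed

context banach_over
begin

text \<open>The operator rotates, for each \<open>k\<close> and each \<open>p \<in> P\<close>, the plane of \<open>u = v k p False\<close> and \<open>w = v k p True\<close> by the
angle \<open>\<theta> k\<close>. The coordinate that belongs to \<open>u\<close> is not \<open>h k p False\<close> but its tilt by \<open>K k * g k p\<close>, which is
still biorthogonal since \<open>g\<close> annihilates all planes. The angle at time \<open>n\<close> is \<open>n * \<theta> k\<close>, and
\<open>K k * \<theta> k = 2 * pi / m k\<close>. Hence \<open>g k p x\<close> is felt with full strength from the time \<open>m k / 4\<close> on,
until a quarter turn is completed at \<open>m (k + 1) / 4\<close> and the next \<open>k\<close> takes over. At time \<open>n = m k\<close> all earlier planes
have made full turns, the planes of \<open>k\<close> contribute a multiple of the norms of the \<open>g k p x\<close>, and the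
later ones have hardly moved.\<close>

lemma operator_from_block_rotations:
  fixes v :: "nat \<Rightarrow> 'p \<Rightarrow> bool \<Rightarrow> 'a" and h :: "nat \<Rightarrow> 'p \<Rightarrow> bool \<Rightarrow> 'a \<Rightarrow> 'k"
    and g :: "nat \<Rightarrow> 'p \<Rightarrow> 'a \<Rightarrow> 'k"
  assumes P: "finite P" "P \<noteq> {}" and "0 < (C::real)"
    and h_lin: "\<And>k p \<beta>. Vector_Spaces.linear smul (*) (h k p \<beta>)"
    and h_bound: "\<And>k p \<beta> x. norm (h k p \<beta> x) \<le> C * norm x"
    and v_bound: "\<And>k p \<beta>. norm (v k p \<beta>) \<le> C"
    and biorth: "\<And>k p \<beta> l q \<beta>'. h k p \<beta> (v l q \<beta>') = (if k = l \<and> p = q \<and> \<beta> = \<beta>' then 1 else 0)"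
    and g_lin: "\<And>k p. Vector_Spaces.linear smul (*) (g k p)"
    and g_bound: "\<And>k p x. norm (g k p x) \<le> \<gamma> k * norm x"
    and g_v: "\<And>k p l q \<beta>. g k p (v l q \<beta>) = 0"
  obtains R where "bounded_operator smul smul R"
    "\<And>x. filterlim (\<lambda>k. \<Sum>p\<in>P. norm (g k p x)) at_top sequentially \<Longrightarrow>
       filterlim (\<lambda>n. norm ((R ^^ n) x)) at_top sequentially"
    "\<And>x r. strict_mono r \<Longrightarrow> (\<lambda>i. \<Sum>p\<in>P. norm (g (r i) p x)) \<longlonglongrightarrow> 0 \<Longrightarrow>
       \<exists>r'::nat \<Rightarrow> nat. strict_mono r' \<and> (\<lambda>i. (R ^^ r' i) x) \<longlonglongrightarrow> x"
proof -
  define D where "D = real (card P)"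
  have D_pos: "0 < D" using P by (simp add: D_def card_gt_0_iff)
  define \<Gamma> where "\<Gamma> k x = (\<Sum>p\<in>P. norm (g k p x))" for k x
  have \<Gamma>_nonneg: "0 \<le> \<Gamma> k x" for k x by (simp add: \<Gamma>_def sum_nonneg)
  define \<gamma>' where "\<gamma>' k = D * \<bar>\<gamma> k\<bar>" for k
  have \<gamma>'_nonneg: "0 \<le> \<gamma>' k" for k using D_pos by (simp add: \<gamma>'_def)
  have \<Gamma>_bound: "\<Gamma> k x \<le> \<gamma>' k * norm x" for k x
  proof -
    have "norm (g k p x) \<le> \<bar>\<gamma> k\<bar> * norm x" for p
      by (rule order.trans[OF g_bound mult_right_mono]) auto
    then have "\<Gamma> k x \<le> (\<Sum>p\<in>P. \<bar>\<gamma> k\<bar> * norm x)" unfolding \<Gamma>_def by (intro sum_mono)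
    then show ?thesis by (simp add: \<gamma>'_def D_def)
  qed
  obtain m :: "nat \<Rightarrow> nat" where m: "\<And>k. 0 < m k" "\<And>j k. j \<le> k \<Longrightarrow> m j dvd m k"
    "\<And>k. (\<gamma>' k + 1) * 4 ^ k \<le> m k" "\<And>j k. j < k \<Longrightarrow> real (m j) * ((\<gamma>' k + 1) * 4 ^ k) \<le> m k"
    using fast_divisibility_chain[of \<gamma>'] \<gamma>'_nonneg by blast
  define \<theta> where "\<theta> k = 2 * pi / m (Suc k)" for k
  define K where "K k = real (m (Suc k)) / m k" for k
  have K_pos: "0 < K k" for k using m(1) by (simp add: K_def)

  define a where "a k p x = h k p False x + of_real (K k) * g k p x" for k p x
  define b where "b k p = h k p True" for k p
  define u where "u k p = v k p False" for k p
  define w where "w k p = v k p True" for k p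
  have h_add: "h k p \<beta> (x + y) = h k p \<beta> x + h k p \<beta> y"
    and h_scale: "h k p \<beta> (smul t x) = t * h k p \<beta> x" for k p \<beta> x y t
    using h_lin[of k p \<beta>] by (auto simp: Vector_Spaces.linear_iff)
  have g_add: "g k p (x + y) = g k p x + g k p y"
    and g_scale: "g k p (smul t x) = t * g k p x" for k p x y t
    using g_lin[of k p] by (auto simp: Vector_Spaces.linear_iff)
  have a_lin: "Vector_Spaces.linear smul (*) (a k p)" for k p
    by (rule linear_functionalI) (simp_all add: a_def h_add h_scale g_add g_scale algebra_simps)
  have b_lin: "Vector_Spaces.linear smul (*) (b k p)" for k p
    using h_lin by (simp add: b_def)
  have a_bound: "norm (a k p x) \<le> K k * norm (g k p x) + C * norm x" for k p x
  proof -
    have "norm (a k p x) \<le> norm (h k p False x) + norm (of_real (K k) * g k p x)"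
      unfolding a_def by (rule norm_triangle_ineq)
    also have "\<dots> \<le> C * norm x + K k * norm (g k p x)"
      using K_pos[of k] by (intro add_mono h_bound) (simp add: norm_mult)
    finally show ?thesis by simp
  qed
  have b_bound: "norm (b k p x) \<le> C * norm x" for k p x using h_bound by (simp add: b_def)
  have au: "a k p (u l q) = (if k = l \<and> p = q then 1 else 0)"
    and aw: "a k p (w l q) = 0" and bu: "b k p (u l q) = 0"
    and bw: "b k p (w l q) = (if k = l \<and> p = q then 1 else 0)" for k p l q
    by (simp_all add: a_def b_def u_def w_def biorth g_v)

  \<comment> \<open>\<open>Q k\<close> is the infinitesimal rotation of the planes with index \<open>k\<close>; its square is of the same shape
    \<open>F\<close>, which is why both are estimated together. A bound of \<open>Q k (Q k x)\<close> by the operator norm of \<open>Q k\<close>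
    would cost a second factor \<open>K k\<close>.\<close>
  define F where "F s t k x = (\<Sum>p\<in>P. smul (s k p x) (u k p) + smul (t k p x) (w k p))"
    for s t :: "nat \<Rightarrow> 'p \<Rightarrow> 'a \<Rightarrow> 'k" and k x
  define Q where "Q = F (\<lambda>k p x. - b k p x) a"
  have F_bound: "norm (F s t k x) \<le> C * (1 + 2 * C * D) * (K k * \<Gamma> k x + norm x)"
    if "\<And>p. norm (s k p x) + norm (t k p x) \<le> K k * norm (g k p x) + 2 * C * norm x" for s t k x
  proof -
    have "norm (F s t k x) \<le> (\<Sum>p\<in>P. C * (K k * norm (g k p x) + 2 * C * norm x))"
      unfolding F_def
    proof (intro sum_norm_le)
      fix p
      have "norm (smul (s k p x) (u k p) + smul (t k p x) (w k p))
          \<le> norm (s k p x) * norm (u k p) + norm (t k p x) * norm (w k p)"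
        by (rule norm_triangle_le) (simp add: norm_smul)
      also have "\<dots> \<le> norm (s k p x) * C + norm (t k p x) * C"
        unfolding u_def w_def by (intro add_mono mult_left_mono v_bound) auto
      also have "\<dots> = C * (norm (s k p x) + norm (t k p x))" by (simp add: algebra_simps)
      also have "\<dots> \<le> C * (K k * norm (g k p x) + 2 * C * norm x)"
        using that[of p] \<open>0 < C\<close> by (intro mult_left_mono) auto
      finally show "norm (smul (s k p x) (u k p) + smul (t k p x) (w k p))
          \<le> C * (K k * norm (g k p x) + 2 * C * norm x)" .
    qed
    also have "\<dots> = C * (1 * (K k * \<Gamma> k x) + (2 * C * D) * norm x)"
      by (simp add: \<Gamma>_def D_def sum_distrib_left sum.distrib algebra_simps)
    also have "\<dots> \<le> C * ((1 + 2 * C * D) * (K k * \<Gamma> k x) + (1 + 2 * C * D) * norm x)"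
      using \<open>0 < C\<close> D_pos K_pos[of k] \<Gamma>_nonneg[of k x]
      by (intro mult_left_mono add_mono mult_right_mono) auto
    finally show ?thesis by (simp add: algebra_simps)
  qed
  define C' where "C' = C * (1 + 2 * C * D)"
  have C'_pos: "0 < C'" using \<open>0 < C\<close> D_pos by (simp add: C'_def add_pos_pos)
  have ab_bound: "norm (a k p x) + norm (b k p x) \<le> K k * norm (g k p x) + 2 * C * norm x" for k p x
    using a_bound[of k p x] b_bound[of k p x] by linarith
  have Q_bound: "norm (Q k x) \<le> C' * (K k * \<Gamma> k x + norm x)" for k x
    unfolding Q_def C'_def using ab_bound by (intro F_bound) (simp add: add.commute)

  have functional_F: "\<phi> (F s t k x) = (\<Sum>p\<in>P. s k p x * \<phi> (u k p) + t k p x * \<phi> (w k p))"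
    if \<phi>: "Vector_Spaces.linear smul (*) \<phi>" for \<phi> s t k x
  proof -
    interpret Vector_Spaces.linear smul "(*)" \<phi> by (rule \<phi>)
    show ?thesis by (simp add: F_def sum add scale)
  qed
  have aQ: "a k p (Q l x) = (if k = l then - b k p x else 0)"
    and bQ: "b k p (Q l x) = (if k = l then a k p x else 0)" if "p \<in> P" for k l p x
    using that P(1) by (simp_all add: Q_def functional_F[OF a_lin] functional_F[OF b_lin]
        au aw bu bw sum.delta if_distrib[of "\<lambda>t. _ * t"] cong: if_cong)
  have Q_Q: "Q k (Q l x) = (if k = l then F (\<lambda>k p x. - a k p x) (\<lambda>k p x. - b k p x) k x else 0)" for k l x
    unfolding Q_def[THEN fun_cong, THEN fun_cong, of k "Q l x"]
    by (simp add: F_def aQ bQ minus_diff_commute cong: sum.cong)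
  have QQ_bound: "norm (Q k (Q k x)) \<le> C' * (K k * \<Gamma> k x + norm x)" for k x
    using F_bound[of "\<lambda>k p x. - a k p x" k x "\<lambda>k p x. - b k p x"] ab_bound[of k _ x]
    by (simp add: Q_Q C'_def)
  have QQQ: "Q k (Q k (Q k x)) = - Q k x" for k x
  proof -
    have "Q k (Q k (Q k x)) = F (\<lambda>k p x. b k p x) (\<lambda>k p x. - a k p x) k x"
      unfolding Q_def[THEN fun_cong, THEN fun_cong, of k "Q k (Q k x)"]
      by (simp add: F_def aQ bQ cong: sum.cong)
    also have "\<dots> = - Q k x"
      by (simp add: F_def Q_def sum_negf[symmetric])
    finally show ?thesis .
  qed

  have Q_lin: "Vector_Spaces.linear smul smul (Q k)" for k
  proof (rule linear_smulI)
    have ab: "a k p (x + y) = a k p x + a k p y" "b k p (x + y) = b k p x + b k p y"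
      "a k p (smul t x) = t * a k p x" "b k p (smul t x) = t * b k p x" for p x y t
      using a_lin[of k p] b_lin[of k p] by (auto simp: Vector_Spaces.linear_iff)
    show "Q k (x + y) = Q k x + Q k y" for x y
      unfolding Q_def F_def sum.distrib[symmetric]
      by (rule sum.cong) (simp_all add: ab scale_left_distrib scale_left_diff_distrib)
    show "Q k (smul t x) = smul t (Q k x)" for t x
      unfolding Q_def F_def scale_sum_right
      by (rule sum.cong) (simp_all add: ab scale_right_distrib scale_right_diff_distrib)
  qed
  have Kg: "C' * (K k * \<Gamma> k x + norm x) \<le> C' * (K k * \<gamma>' k + 1) * norm x" for k x
    using \<Gamma>_bound[of k x] K_pos[of k] C'_pos
    by (simp add: mult.assoc ring_distribs mult_le_cancel_left)
  have Q_op: "bounded_operator smul smul (Q k)" for k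
    by (rule bounded_operatorI[OF Q_lin order.trans[OF Q_bound Kg]])
  then have Q_bl: "bounded_linear (Q k)" for k by (simp add: bounded_operator_def)
  define B where "B k = Blinfun (Q k)" for k
  have B_apply [simp]: "blinfun_apply (B k) = Q k" for k
    by (simp add: B_def bounded_linear_Blinfun_apply Q_bl)
  have B_norm: "norm (B k) \<le> C' * (K k * \<gamma>' k + 1)"
    and BB_norm: "norm (B k o\<^sub>L B k) \<le> C' * (K k * \<gamma>' k + 1)" for k
    using C'_pos K_pos[of k] \<gamma>'_nonneg[of k] order.trans[OF Q_bound Kg] order.trans[OF QQ_bound Kg]
    by (intro norm_blinfun_bound; simp)+
  have cube: "B k o\<^sub>L B k o\<^sub>L B k = - B k" for k
    by (rule blinfun_eqI) (simp add: QQQ blinfun.minus_left)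
  have orth: "B k o\<^sub>L B l = 0" if "k \<noteq> l" for k l
    by (rule blinfun_eqI) (simp add: Q_Q that)
  have summ: "summable (\<lambda>k. \<bar>\<theta> k\<bar> * (norm (B k) + norm (B k o\<^sub>L B k)))"
  proof (rule summable_comparison_test'[OF summable_mult[OF summable_geometric[of "1/4"]]])
    fix k
    have "0 \<le> \<theta> k" by (simp add: \<theta>_def)
    moreover have "norm (B k) + norm (B k o\<^sub>L B k) \<le> 2 * (C' * (K k * \<gamma>' k + 1))"
      using B_norm[of k] BB_norm[of k] by linarith
    ultimately have "\<bar>\<theta> k\<bar> * (norm (B k) + norm (B k o\<^sub>L B k)) \<le> \<theta> k * (2 * (C' * (K k * \<gamma>' k + 1)))"
      by (simp only: abs_of_nonneg mult_left_mono)
    also have "\<dots> = 4 * pi * C' * (\<gamma>' k / m k + 1 / m (Suc k))"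
      using m(1)[of k] m(1)[of "Suc k"] by (simp add: \<theta>_def K_def field_simps)
    also have "\<dots> \<le> 4 * pi * C' * (\<gamma>' k / m k + 1 / m k)"
      using C'_pos m(1)[of k] m(1)[of "Suc k"] dvd_imp_le[OF m(2)[of k "Suc k"]] \<gamma>'_nonneg[of k]
      by (intro mult_left_mono add_mono frac_le) auto
    also have "\<dots> \<le> 4 * pi * C' * (1 / 4) ^ k"
      using C'_pos m(1)[of k] m(3)[of k]
      by (intro mult_left_mono) (auto simp: add_divide_distrib[symmetric] field_simps power_divide)
    finally show "norm (\<bar>\<theta> k\<bar> * (norm (B k) + norm (B k o\<^sub>L B k))) \<le> 4 * pi * C' * (1 / 4) ^ k"
      by simp
  qed simp
  obtain R :: "'a \<Rightarrow>\<^sub>L 'a" where R: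
    "\<And>n x. (\<lambda>k. sin (real n * \<theta> k) *\<^sub>R Q k x + (1 - cos (real n * \<theta> k)) *\<^sub>R Q k (Q k x))
       sums ((blinfun_apply R ^^ n) x - x)"
    using rotation_powers[OF cube orth summ, unfolded B_apply] by blast

  show ?thesis
  proof (rule that[of "blinfun_apply R"])
    have "R (smul t x) = smul t (R x)" for t x
    proof -
      have Qs: "Q k (smul t x) = smul t (Q k x)" for k x
        using Q_lin[of k] by (auto simp: Vector_Spaces.linear_iff)
      have "(\<lambda>k. smul t (sin (real 1 * \<theta> k) *\<^sub>R Q k x + (1 - cos (real 1 * \<theta> k)) *\<^sub>R Q k (Q k x)))
          sums smul t ((blinfun_apply R ^^ 1) x - x)"
        by (rule bounded_linear.sums[OF bounded_linear_smul R])
      moreover have "(\<lambda>k. smul t (sin (real 1 * \<theta> k) *\<^sub>R Q k x + (1 - cos (real 1 * \<theta> k)) *\<^sub>R Q k (Q k x)))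
          sums ((blinfun_apply R ^^ 1) (smul t x) - smul t x)"
        using R[where n = 1 and x = "smul t x"]
        by (simp add: Qs scale_right_distrib linear_simps[OF bounded_linear_smul])
      ultimately have "smul t (R x - x) = R (smul t x) - smul t x"
        using sums_unique2 by fastforce
      then show ?thesis by (simp add: scale_right_diff_distrib)
    qed
    then have "Vector_Spaces.linear smul smul R"
      by (intro linear_smulI) (simp_all add: blinfun.add_right)
    then show "bounded_operator smul smul R"
      by (simp add: bounded_operator_def blinfun.bounded_linear_right)
  next
    fix x assume grow: "filterlim (\<lambda>k. \<Sum>p\<in>P. norm (g k p x)) at_top sequentially"
    \<comment> \<open>the coordinate \<open>b k p\<close> of the iterate is \<open>sin t * a k p x + cos t * b k p x\<close> with \<open>t\<close> in the first
      quadrant, and \<open>K k\<close> outweighs the smallness of \<open>sin t\<close>\<close>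
    have window: "\<Gamma> k x / 2 - 2 * C * D * norm x \<le> C * D * norm ((blinfun_apply R ^^ n) x)"
      if n: "m k \<le> 4 * n" "4 * n \<le> m (Suc k)" for k n
    proof -
      let ?y = "(blinfun_apply R ^^ n) x" and ?t = "real n * \<theta> k"
      have t: "?t = pi / 2 * (real (4 * n) / m (Suc k))" by (simp add: \<theta>_def)
      have t_le: "?t \<le> pi / 2"
        unfolding t using n(2) m(1)[of "Suc k"] by (intro mult_left_le) auto
      have t_ge: "pi / 2 * (1 / K k) \<le> ?t"
        unfolding t using n(1) m(1)[of "Suc k"] by (intro mult_left_mono) (auto simp: K_def divide_right_mono)
      have "1 * (1 / K k) \<le> pi / 2 * (1 / K k)"
        using pi_gt3 K_pos[of k] by (intro mult_right_mono) auto
      from order.trans[OF this t_ge] have "1 / K k / 2 \<le> ?t / 2"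
        by (intro divide_right_mono) simp_all
      also have "\<dots> \<le> sin ?t" using t_le by (intro sin_ge_half) (auto simp: \<theta>_def)
      finally have sinK: "1 / 2 \<le> sin ?t * K k" using K_pos[of k] by (simp add: field_simps)
      have coord: "norm (g k p x) / 2 - 2 * C * norm x \<le> C * norm ?y" if "p \<in> P" for p
      proof -
        have bl: "bounded_linear (b k p)"
        proof (rule bounded_linear_intro)
          show "b k p (r *\<^sub>R x) = r *\<^sub>R b k p x" for r x
            by (simp add: b_def smul_of_real[symmetric] h_scale scaleR_conv_of_real)
          show "norm (b k p x) \<le> norm x * C" for x using b_bound[of k p x] by (simp add: mult.commute)
        qed (simp add: b_def h_add)
        let ?T = "\<lambda>l. sin (real n * \<theta> l) *\<^sub>R Q l x + (1 - cos (real n * \<theta> l)) *\<^sub>R Q l (Q l x)"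
        have Tb: "b k p (?T l) = (if l = k then of_real (sin ?t) * a k p x - of_real (1 - cos ?t) * b k p x else 0)" for l
          using that by (simp add: linear_simps[OF bl] bQ aQ scaleR_conv_of_real)
        have "(\<lambda>l. b k p (?T l)) sums b k p (?y - x)"
          by (rule bounded_linear.sums[OF bl R])
        then have "b k p (?y - x) = of_real (sin ?t) * a k p x - of_real (1 - cos ?t) * b k p x"
          unfolding Tb using sums_single[of k "\<lambda>_. of_real (sin ?t) * a k p x - of_real (1 - cos ?t) * b k p x"]
          by (metis (no_types, lifting) sums_unique2)
        then have bRn: "b k p ?y = of_real (sin ?t * K k) * g k p x +
            (of_real (sin ?t) * h k p False x + of_real (cos ?t) * b k p x)"
          by (simp add: linear_simps[OF bl] a_def algebra_simps)
        have "norm (of_real (sin ?t) * h k p False x + of_real (cos ?t) * b k p x)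
            \<le> \<bar>sin ?t\<bar> * (C * norm x) + \<bar>cos ?t\<bar> * (C * norm x)"
          using h_bound[of k p False x] b_bound[of k p x]
          by (intro norm_triangle_mono) (auto simp: norm_mult intro: mult_left_mono)
        also have "\<dots> \<le> 1 * (C * norm x) + 1 * (C * norm x)"
          using \<open>0 < C\<close> by (intro add_mono mult_right_mono) auto
        finally have rest: "norm (of_real (sin ?t) * h k p False x + of_real (cos ?t) * b k p x)
            \<le> 2 * C * norm x" by simp
        have "1 / 2 * norm (g k p x) \<le> (sin ?t * K k) * norm (g k p x)"
          by (rule mult_right_mono[OF sinK]) auto
        also have "\<dots> = norm (of_real (sin ?t * K k) * g k p x)"
          using sinK by (simp only: norm_mult norm_of_real)
        also have "\<dots> \<le> norm (b k p ?y) + 2 * C * norm x"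
          using rest norm_triangle_ineq2[of "of_real (sin ?t * K k) * g k p x" "- (of_real (sin ?t) * h k p False x + of_real (cos ?t) * b k p x)"]
          unfolding bRn by (simp only: norm_minus_cancel diff_minus_eq_add)
        finally show ?thesis using b_bound[of k p ?y] by simp
      qed
      have "(\<Sum>p\<in>P. norm (g k p x) / 2 - 2 * C * norm x) \<le> (\<Sum>p\<in>P. C * norm ?y)"
        by (rule sum_mono, rule coord)
      then show ?thesis
        by (simp add: \<Gamma>_def D_def sum_subtractf sum_divide_distrib algebra_simps)
    qed
    show "filterlim (\<lambda>n. norm ((blinfun_apply R ^^ n) x)) at_top sequentially"
      unfolding filterlim_at_top
    proof
      fix Z :: real
      from grow have "\<forall>\<^sub>F k in sequentially. 2 * (C * D * Z + 2 * C * D * norm x) \<le> \<Gamma> k x"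
        by (simp add: filterlim_at_top \<Gamma>_def)
      then obtain k0 where k0: "\<And>k. k0 \<le> k \<Longrightarrow> 2 * (C * D * Z + 2 * C * D * norm x) \<le> \<Gamma> k x"
        by (auto simp: eventually_sequentially)
      have m_ge: "k \<le> m k" for k
      proof -
        have "real k \<le> 1 * 4 ^ k" using of_nat_less_two_power[of k] power_mono[of "2::real" 4 k] by simp
        also have "\<dots> \<le> (\<gamma>' k + 1) * 4 ^ k" using \<gamma>'_nonneg[of k] by (intro mult_right_mono) auto
        finally show ?thesis using m(3)[of k] by simp
      qed
      show "\<forall>\<^sub>F n in sequentially. Z \<le> norm ((blinfun_apply R ^^ n) x)"
        unfolding eventually_sequentially
      proof (intro exI allI impI)
        fix n assume n: "m k0 \<le> n"
        \<comment> \<open>the window that contains \<open>n\<close> belongs to the largest \<open>k\<close> with \<open>m k \<le> 4 * n\<close>\<close>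
        define W where "W = {k. m k \<le> 4 * n}"
        have "W \<subseteq> {..4 * n}"
        proof
          fix l assume "l \<in> W"
          then show "l \<in> {..4 * n}" using m_ge[of l] by (simp add: W_def)
        qed
        then have fin: "finite W" using finite_subset by blast
        have k0W: "k0 \<in> W" using n by (simp add: W_def)
        define k where "k = Max W"
        have "k \<in> W" using fin k0W by (auto simp: k_def intro: Max_in)
        moreover have "Suc k \<notin> W" using Max_ge[OF fin, of "Suc k"] unfolding k_def by linarith
        ultimately have "\<Gamma> k x / 2 - 2 * C * D * norm x \<le> C * D * norm ((blinfun_apply R ^^ n) x)"
          by (intro window) (auto simp: W_def)
        moreover have "2 * (C * D * Z + 2 * C * D * norm x) \<le> \<Gamma> k x"
          by (rule k0) (use fin k0W in \<open>simp add: k_def\<close>)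
        ultimately have "C * D * Z \<le> C * D * norm ((blinfun_apply R ^^ n) x)"
          by (simp add: algebra_simps)
        then show "Z \<le> norm ((blinfun_apply R ^^ n) x)"
          using \<open>0 < C\<close> D_pos by (simp add: mult_le_cancel_left)
      qed
    qed
  next
    fix x and r :: "nat \<Rightarrow> nat"
    assume r: "strict_mono r" and lim: "(\<lambda>i. \<Sum>p\<in>P. norm (g (r i) p x)) \<longlonglongrightarrow> 0"
    have near: "norm ((blinfun_apply R ^^ m j) x - x)
        \<le> 4 * pi * C' * \<Gamma> j x + 4 * pi * C' * norm x * ((1 / 2) ^ j * 2)" for j
    proof -
      let ?T = "\<lambda>k. sin (real (m j) * \<theta> k) *\<^sub>R Q k x + (1 - cos (real (m j) * \<theta> k)) *\<^sub>R Q k (Q k x)"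
      let ?c = "4 * pi * C'"
      \<comment> \<open>The powers of 4 in the growth of \<open>m\<close> are split in two: one factor makes the series
        converge, the other one makes its sum tend to 0 with \<open>j\<close>.\<close>
      have Tb: "norm (?T k) \<le> (if k = j then ?c * \<Gamma> j x else 0) + ?c * norm x * ((1/2) ^ j * (1/2) ^ k)" for k
      proof (cases "k < j")
        case True
        then obtain q where q: "m j = m (Suc k) * q" using m(2)[of "Suc k" j] by (auto elim: dvdE)
        have "real (m j) * \<theta> k = 2 * pi * real q"
          using m(1)[of "Suc k"] by (simp add: \<theta>_def q)
        then have "?T k = 0" using sin_npi[of "2 * q"] cos_2npi[of q]
          by (simp add: mult_ac)
        then show ?thesis using True C'_pos by simp
      next
        case False
        let ?t = "real (m j) * \<theta> k" and ?b = "C' * (K k * \<Gamma> k x + norm x)"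
        have t0: "0 \<le> ?t" by (simp add: \<theta>_def)
        have s: "\<bar>sin ?t\<bar> \<le> ?t" using abs_sin_x_le_abs_x[of ?t] t0 by simp
        have c: "\<bar>1 - cos ?t\<bar> \<le> ?t" using abs_one_minus_cos_le[of ?t] t0 by simp
        have "norm (?T k) \<le> \<bar>sin ?t\<bar> * norm (Q k x) + \<bar>1 - cos ?t\<bar> * norm (Q k (Q k x))"
          by (rule order.trans[OF norm_triangle_ineq]) simp
        also have "\<dots> \<le> ?t * ?b + ?t * ?b"
          using t0 by (intro add_mono mult_mono s c Q_bound QQ_bound) auto
        also have "\<dots> = ?c * (m j / m k * \<Gamma> k x + m j / m (Suc k) * norm x)"
          using m(1)[of k] m(1)[of "Suc k"] by (simp add: \<theta>_def K_def field_simps)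
        finally have T_le: "norm (?T k) \<le> ?c * (m j / m k * \<Gamma> k x + m j / m (Suc k) * norm x)" .
        have quarter: "(1/4) ^ k \<le> (1/2::real) ^ j * (1/2) ^ k" if "j \<le> k"
        proof -
          have "(1/4::real) ^ k = (1/2) ^ k * (1/2) ^ k" by (simp add: power_mult_distrib[symmetric])
          also have "\<dots> \<le> (1/2) ^ j * (1/2) ^ k"
            using that by (intro mult_right_mono power_decreasing) auto
          finally show ?thesis .
        qed
        have ratio: "m i / m l * (\<gamma>' l + 1) \<le> (1/4) ^ l" if "i < l" for i l
          using m(4)[OF that] m(1)[of l] by (simp add: field_simps power_divide)
        have ratio1: "real (m i) / m l \<le> (1/4) ^ l" if "i < l" for i l
          using ratio[OF that] mult_left_mono[of 1 "\<gamma>' l + 1" "real (m i) / m l"] \<gamma>'_nonneg[of l]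
          by simp
        show ?thesis
        proof (cases "k = j")
          case True
          have "m j / m (Suc k) \<le> (1/4) ^ Suc k" using ratio1[of j "Suc k"] True by simp
          also have "\<dots> \<le> (1/4) ^ k" by (intro power_decreasing) auto
          also note quarter
          finally have "?c * (m j / m (Suc k) * norm x) \<le> ?c * ((1/2) ^ j * (1/2) ^ k * norm x)"
            using C'_pos True by (intro mult_left_mono mult_right_mono) auto
          then show ?thesis using T_le True m(1)[of j] by (simp add: algebra_simps)
        next
          case False
          with \<open>\<not> k < j\<close> have "j < k" by simp
          have "m j / m k * \<Gamma> k x + m j / m (Suc k) * norm x
              \<le> m j / m k * (\<gamma>' k * norm x) + m j / m k * norm x"
            using \<Gamma>_bound m(1) dvd_imp_le[OF m(2)[of k "Suc k"]]
            by (intro add_mono mult_left_mono mult_right_mono divide_left_mono) auto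
          also have "\<dots> = m j / m k * (\<gamma>' k + 1) * norm x"
            by (simp add: algebra_simps add_divide_distrib)
          also have "\<dots> \<le> ((1/2) ^ j * (1/2) ^ k) * norm x"
            using ratio[OF \<open>j < k\<close>] quarter \<open>j < k\<close> by (intro mult_right_mono) auto
          finally have "?c * (m j / m k * \<Gamma> k x + m j / m (Suc k) * norm x)
              \<le> ?c * (((1/2) ^ j * (1/2) ^ k) * norm x)"
            using C'_pos by (intro mult_left_mono) auto
          then show ?thesis using T_le False by (simp add: algebra_simps)
        qed
      qed
      have "(\<lambda>k. (1/2) ^ k) sums (2::real)" using geometric_sums[of "1/2::real"] by simp
      then have S: "(\<lambda>k. (if k = j then ?c * \<Gamma> j x else 0) + ?c * norm x * ((1/2) ^ j * (1/2) ^ k))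
          sums (?c * \<Gamma> j x + ?c * norm x * ((1 / 2) ^ j * 2))"
        by (intro sums_add sums_mult) (use sums_single[of j "\<lambda>_. ?c * \<Gamma> j x"] in simp_all)
      have "norm (\<Sum>k. ?T k) \<le> (\<Sum>k. (if k = j then ?c * \<Gamma> j x else 0) +
          ?c * norm x * ((1/2) ^ j * (1/2) ^ k))"
        by (rule norm_suminf_le[OF Tb sums_summable[OF S]])
      then show ?thesis
        unfolding sums_unique[OF S, symmetric] sums_unique[OF R[rule_format], symmetric] .
    qed
    have mono: "strict_mono m"
      unfolding strict_mono_Suc_iff
    proof
      fix k
      have "real (m k) * 1 < real (m k) * ((\<gamma>' (Suc k) + 1) * 4 ^ Suc k)"
      proof (rule mult_strict_left_mono)
        have "1 * 1 < (\<gamma>' (Suc k) + 1) * (4::real) ^ Suc k"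
          using \<gamma>'_nonneg[of "Suc k"] by (intro mult_le_less_imp_less one_less_power) auto
        then show "1 < (\<gamma>' (Suc k) + 1) * 4 ^ Suc k" by simp
      qed (simp add: m(1))
      then show "m k < m (Suc k)" using m(4)[of k "Suc k"] by linarith
    qed
    show "\<exists>r'::nat \<Rightarrow> nat. strict_mono r' \<and> (\<lambda>i. (blinfun_apply R ^^ r' i) x) \<longlonglongrightarrow> x"
    proof (intro exI conjI)
      show "strict_mono (\<lambda>i. m (r i))" using mono r by (simp add: strict_mono_def)
      have half: "(\<lambda>i. (1 / 2 :: real) ^ r i) \<longlonglongrightarrow> 0"
        using LIMSEQ_subseq_LIMSEQ[OF LIMSEQ_power_zero[of "1/2::real"] r] by (simp add: o_def)
      have "(\<lambda>i. 4 * pi * C' * \<Gamma> (r i) x + 4 * pi * C' * norm x * ((1 / 2) ^ r i * 2)) \<longlonglongrightarrow>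
          4 * pi * C' * 0 + 4 * pi * C' * norm x * (0 * 2)"
        using lim half by (intro tendsto_intros) (auto simp: \<Gamma>_def)
      then have "(\<lambda>i. (blinfun_apply R ^^ m (r i)) x - x) \<longlonglongrightarrow> 0"
        by (intro Lim_null_comparison[OF always_eventually[OF allI[OF near]]]) simp
      then show "(\<lambda>i. (blinfun_apply R ^^ m (r i)) x) \<longlonglongrightarrow> x"
        by (simp add: LIM_zero_iff)
    qed
  qed
qed

end

context banach_over
begin

section \<open>Construction of the operator\<close>

lemma wedge_zero_imp_scalar_multiple:
  assumes lin: "\<And>i. Vector_Spaces.linear smul (*) (f i)"
    and sep: "\<And>y. y \<in> Y \<Longrightarrow> (\<And>i. i < N \<Longrightarrow> f i y = 0) \<Longrightarrow> y = 0"
    and Y: "subspace Y" "y \<in> Y" "z \<in> Y" "z \<noteq> 0"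
    and wedge: "\<And>i j. i < N \<Longrightarrow> j < N \<Longrightarrow> f i y * f j z = f j y * f i z"
  shows "\<exists>t. y = smul t z"
proof -
  obtain j where j: "j < N" "f j z \<noteq> 0" using sep Y by blast
  define t where "t = f j y / f j z"
  have "y - smul t z \<in> Y" using Y by (simp add: subspace_diff subspace_scale)
  moreover have "f i (y - smul t z) = 0" if "i < N" for i
  proof -
    interpret Vector_Spaces.linear smul "(*)" "f i" by (rule lin)
    show ?thesis using wedge[OF that j(1)] j(2) by (simp add: diff scale t_def field_simps)
  qed
  ultimately have "y - smul t z = 0" by (rule sep)
  then show ?thesis by auto
qed

lemma finite_dim_basis:
  assumes "subspace Y" "0 < dim Y"
  obtains B where "finite B" "span B = Y"
proof -
  obtain B where B: "B \<subseteq> Y" "independent B" "Y \<subseteq> span B" "card B = dim Y"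
    using basis_exists by blast
  have "finite B" using B(4) assms(2) card_gt_0_iff by metis
  moreover have "span B = Y" using B assms(1) by (simp add: span_subspace)
  ultimately show ?thesis using that by blast
qed

end

theorem theorem1p2:
  fixes smul :: "'k::real_or_complex \<Rightarrow> 'a::banach \<Rightarrow> 'a"
    and e :: "nat \<Rightarrow> 'a"
    and Y E :: "'a set"
    and d :: nat
    and J :: "'a \<Rightarrow> 'a"
  assumes "banach_over smul"
    and "infinite_dimensional smul"
    and "symmetric_basis smul e"
    and "symmetric_norm smul e"
    and "module.subspace smul Y"
    and "vector_space.dim smul Y = d"
    and "2 \<le> d"
    and "E \<subseteq> unit_sphere Y"
    and "closed E"
    and "symmetric_set smul E"
    and "projection_onto smul Y J"
  shows "\<exists>R. bounded_operator smul smul R \<and>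
    (\<forall>x. J x \<in> E \<longrightarrow> filterlim (\<lambda>n. norm ((R ^^ n) x)) at_top sequentially) \<and>
    (\<forall>x. J x \<in> unit_sphere Y - E \<longrightarrow>
       (\<exists>r :: nat \<Rightarrow> nat. strict_mono r \<and> weakly_converges smul (\<lambda>i. (R ^^ r i) x) x))"
proof -
  interpret banach_over smul by (rule assms(1))
  have Y: "subspace Y" by (rule assms(5))
  obtain f c where c: "0 < (c::real)"
    and f_lin: "\<And>i. Vector_Spaces.linear smul (*) (f i)"
    and f_e: "\<And>i l. f i (e l) = (if i = l then 1 else 0)"
    and f_bound: "\<And>i x. norm (f i x) * c \<le> norm x"
    and e_norm: "\<And>i. norm (e i) = c"
    and f_sums: "\<And>x. (\<lambda>i. smul (f i x) (e i)) sums x"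
    by (rule coordinate_functionals[OF _ assms(4)])
      (use assms(3) in \<open>auto simp: symmetric_basis_def\<close>)
  have f_bound': "norm (f i x) \<le> 1 / c * norm x" for i x
    using f_bound[of i x] c by (simp add: field_simps)
  have f_add: "f i (x + y) = f i x + f i y" and f_scale: "f i (smul t x) = t * f i x" for i x y t
    using f_lin[of i] by (auto simp: Vector_Spaces.linear_iff)
  have f_diff: "f i (x - y) = f i x - f i y" for i x y
    using f_add[of i "x - y" y] by simp
  have f_0: "f i 0 = 0" for i
    using f_scale[of i 0 0] by simp

  obtain B0 where B0: "finite B0" "span B0 = Y"
    using finite_dim_basis[OF Y] assms(6,7) by auto
  obtain P N where P: "bounded_operator smul smul P" and P_e: "\<And>l. N \<le> l \<Longrightarrow> P (e l) = 0"
    and P_range: "\<And>x. P x \<in> Y" and P_id: "\<And>y. y \<in> Y \<Longrightarrow> P y = y"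
    by (rule projection_killing_tail[OF c f_lin f_e f_bound f_sums B0(1), unfolded B0(2)]) auto
  have P_bl: "bounded_linear P" and P_add: "P (x + y) = P x + P y"
    and P_scale: "P (smul t x) = smul t (P x)" for x y t
    using P by (auto simp: bounded_operator_def Vector_Spaces.linear_iff)
  have J_bl: "bounded_linear J" and J_add: "J (x + y) = J x + J y"
    and J_scale: "J (smul t x) = smul t (J x)" and JJ: "J (J x) = J x" and J_Y: "J x \<in> Y" for x y t
    using assms(11) by (auto simp: projection_onto_def bounded_operator_def Vector_Spaces.linear_iff
        fun_eq_iff)

  have rep: "y = (\<Sum>i<N. smul (f i y) (P (e i)))" if y: "y \<in> Y" for y
  proof -
    have "(\<lambda>i. P (smul (f i y) (e i))) sums P y"
      by (rule bounded_linear.sums[OF P_bl f_sums])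
    moreover have "(\<lambda>i. P (smul (f i y) (e i))) sums (\<Sum>i<N. P (smul (f i y) (e i)))"
      by (rule sums_finite) (auto simp: P_scale P_e)
    ultimately show ?thesis by (simp add: P_id[OF y] P_scale sums_unique2)
  qed
  have sep: "y = 0" if "y \<in> Y" "\<And>i. i < N \<Longrightarrow> f i y = 0" for y
    using rep[OF that(1)] that(2) by simp
  have "y \<in> Y \<longleftrightarrow> P y = y" for y
    using P_id P_range[of y] by metis
  then have comp: "compact (unit_sphere Y)"
    using rep f_bound' by (rule compact_unit_sphere_of_projection[OF P_bl])

  show ?thesis
  proof (cases "E = unit_sphere Y")
    case True
    \<comment> \<open>There is no point outside of \<open>E\<close> to build nets from, and none that has to return.\<close>
    define R where "R = (\<lambda>x. smul 2 x)"
    have "bounded_operator smul smul R"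
      by (rule bounded_operatorI[of _ 2], rule linear_smulI)
        (simp_all add: R_def scale_right_distrib norm_smul)
    moreover have "filterlim (\<lambda>n. norm ((R ^^ n) x)) at_top sequentially" if "J x \<in> E" for x
    proof -
      have "J 0 = 0" by (rule linear_simps(3)[OF J_bl])
      then have "0 < norm x" using that True by (auto simp: unit_sphere_def)
      moreover have "norm ((R ^^ n) x) = 2 ^ n * norm x" for n
        by (induction n) (simp_all add: R_def norm_smul)
      moreover have "filterlim (\<lambda>n. (2::real) ^ n) at_top sequentially"
        by (rule filterlim_at_top_mono[OF filterlim_real_sequentially])
          (simp add: of_nat_less_two_power less_imp_le)
      ultimately show ?thesis
        by (simp add: filterlim_at_top_mult_tendsto_pos[OF tendsto_const])
    qed
    ultimately show ?thesis using True by blast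
  next
    case False
    \<comment> \<open>the size of the wedge product of \<open>y\<close> and \<open>z\<close>, in the coordinates that determine points of \<open>Y\<close>\<close>
    define \<Phi> where "\<Phi> y z = (\<Sum>(i, j)\<in>{..<N} \<times> {..<N}. norm (f i y * f j z - f j y * f i z))" for y z
    have \<Phi>_nonneg: "0 \<le> \<Phi> y z" for y z
      unfolding \<Phi>_def by (intro sum_nonneg) auto
    have f_bl: "bounded_linear (f i)" for i
    proof (rule bounded_linear_intro)
      show "f i (r *\<^sub>R x) = r *\<^sub>R f i x" for r x
        by (simp add: smul_of_real[symmetric] f_scale scaleR_conv_of_real)
      show "norm (f i x) \<le> norm x * (1 / c)" for x using f_bound'[of i x] by simp
    qed (rule f_add)
    obtain z \<alpha> where z: "\<And>k. z k \<in> unit_sphere Y" and \<alpha>: "\<And>k. 0 \<le> \<alpha> k"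
      and escape: "\<And>y. y \<in> E \<Longrightarrow> filterlim (\<lambda>k. \<alpha> k * \<Phi> y (z k)) at_top sequentially"
      and return: "\<And>y. y \<in> unit_sphere Y - E \<Longrightarrow>
        \<exists>r::nat \<Rightarrow> nat. strict_mono r \<and> (\<lambda>i. \<alpha> (r i) * \<Phi> y (z (r i))) \<longlonglongrightarrow> 0"
    proof (rule escape_and_return_sequence[OF comp assms(9,8) False, of \<Phi>])
      show "continuous_on (unit_sphere Y \<times> unit_sphere Y) (\<lambda>(y, z). \<Phi> y z)"
        unfolding \<Phi>_def split_beta
        by (intro continuous_intros bounded_linear.continuous_on[OF f_bl])
      show "\<Phi> z z = 0" for z by (simp add: \<Phi>_def mult.commute split_beta)
      show "0 \<le> \<Phi> y z" for y z by (rule \<Phi>_nonneg)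
      show "0 < \<Phi> y z" if y: "y \<in> E" and z: "z \<in> unit_sphere Y - E" for y z
      proof (rule ccontr)
        assume "\<not> 0 < \<Phi> y z"
        then have "\<Phi> y z = 0" using \<Phi>_nonneg[of y z] by linarith
        then have wedge: "f i y * f j z = f j y * f i z" if "i < N" "j < N" for i j
          using that by (auto simp: \<Phi>_def sum_nonneg_eq_0_iff split_beta)
        have "y \<in> Y" "norm y = 1" "z \<in> Y" "norm z = 1"
          using y z assms(8) by (auto simp: unit_sphere_def)
        then obtain t where t: "y = smul t z"
          using wedge_zero_imp_scalar_multiple[OF f_lin sep Y _ _ _ wedge] by fastforce
        \<comment> \<open>the symmetry of \<open>E\<close> excludes that \<open>z\<close> is a multiple of \<open>y\<close>\<close>
        then have "norm t = 1" using \<open>norm y = 1\<close> \<open>norm z = 1\<close> by (simp add: norm_smul)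
        then have "t \<noteq> 0" by auto
        then have "z = smul (inverse t) y" by (simp add: t)
        then have "z \<in> E"
          using assms(10) y \<open>norm t = 1\<close> by (simp add: symmetric_set_def norm_inverse)
        then show False using z by simp
      qed
    qed blast

    obtain KJ where KJ: "\<And>x. norm (J x) \<le> norm x * KJ" "0 \<le> KJ"
      using bounded_linear.nonneg_bounded[OF J_bl] by blast
    obtain KP where KP: "\<And>x. norm (P x) \<le> norm x * KP" "0 \<le> KP"
      using bounded_linear.nonneg_bounded[OF P_bl] by blast
    \<comment> \<open>an injective choice of basis vectors that are annihilated by \<open>P\<close>\<close>
    define \<iota> :: "nat \<Rightarrow> nat \<times> nat \<Rightarrow> bool \<Rightarrow> nat" where "\<iota> k p \<beta> = N + to_nat (k, p, \<beta>)" for k p \<beta>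
    define v where "v k p \<beta> = e (\<iota> k p \<beta>) - J (e (\<iota> k p \<beta>))" for k p \<beta>
    define h where "h k p \<beta> x = f (\<iota> k p \<beta>) (x - P x)" for k p \<beta> x
    define g where "g k = (\<lambda>(i, j) x. of_real (\<alpha> k) * (f i (J x) * f j (z k) - f j (J x) * f i (z k)))" for k
    define C where "C = max (c * (1 + KJ)) (1 / c * (1 + KP))"
    define \<gamma> where "\<gamma> k = \<alpha> k * (2 * (1 / c * KJ) * (1 / c))" for k
    have C_pos: "0 < C" using c KJ(2) by (simp add: C_def less_max_iff_disj)
    have hJ: "h k p \<beta> (J x) = 0" for k p \<beta> x
      by (simp add: h_def P_id[OF J_Y] f_0)
    have h_lin: "Vector_Spaces.linear smul (*) (h k p \<beta>)" for k p \<beta>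
      by (rule linear_functionalI)
        (simp_all add: h_def P_add P_scale f_add f_diff f_scale algebra_simps)
    have h_bound: "norm (h k p \<beta> x) \<le> C * norm x" for k p \<beta> x
    proof -
      have "norm (h k p \<beta> x) \<le> 1 / c * norm (x - P x)" unfolding h_def by (rule f_bound')
      also have "\<dots> \<le> 1 / c * (norm x + norm x * KP)"
        using c norm_triangle_ineq4[of x "P x"] KP(1)[of x] by (intro mult_left_mono) auto
      also have "\<dots> = (1 / c * (1 + KP)) * norm x" by (simp add: algebra_simps add_divide_distrib)
      also have "\<dots> \<le> C * norm x" by (intro mult_right_mono) (auto simp: C_def)
      finally show ?thesis .
    qed
    have v_bound: "norm (v k p \<beta>) \<le> C" for k p \<beta>
    proof -
      have "norm (v k p \<beta>) \<le> c + c * KJ"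
        unfolding v_def using norm_triangle_ineq4[of "e (\<iota> k p \<beta>)" "J (e (\<iota> k p \<beta>))"]
          KJ(1)[of "e (\<iota> k p \<beta>)"] by (simp add: e_norm)
      also have "\<dots> \<le> C" by (simp add: C_def algebra_simps)
      finally show ?thesis .
    qed
    have biorth: "h k p \<beta> (v l q \<beta>') = (if k = l \<and> p = q \<and> \<beta> = \<beta>' then 1 else 0)" for k p \<beta> l q \<beta>'
    proof -
      have "h k p \<beta> (v l q \<beta>') = h k p \<beta> (e (\<iota> l q \<beta>')) - h k p \<beta> (J (e (\<iota> l q \<beta>')))"
      proof -
        interpret hk: Vector_Spaces.linear smul "(*)" "h k p \<beta>" by (rule h_lin)
        show ?thesis unfolding v_def by (rule hk.diff)
      qed
      \<comment> \<open>the corrections by \<open>J\<close> and \<open>P\<close> do not interact: \<open>h\<close> kills the range of \<open>J\<close>, and \<open>P\<close> kills \<open>e\<close>\<close>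
      also have "\<dots> = f (\<iota> k p \<beta>) (e (\<iota> l q \<beta>'))"
        unfolding hJ by (simp add: h_def P_e \<iota>_def)
      also have "\<dots> = (if k = l \<and> p = q \<and> \<beta> = \<beta>' then 1 else 0)" by (auto simp: f_e \<iota>_def)
      finally show ?thesis .
    qed
    have Jv: "J (v k p \<beta>) = 0" for k p \<beta>
      unfolding v_def by (simp add: linear_simps[OF J_bl] JJ)
    have g_lin: "Vector_Spaces.linear smul (*) (g k p)" for k p
      by (rule linear_functionalI)
        (simp_all add: g_def split_beta J_add J_scale f_add f_scale algebra_simps)
    have g_v: "g k p (v l q \<beta>) = 0" for k p l q \<beta>
      by (simp add: g_def split_beta Jv f_0)
    have g_bound: "norm (g k p x) \<le> \<gamma> k * norm x" for k p x
    proof -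
      have J': "norm (f i (J x)) \<le> 1 / c * KJ * norm x" for i
      proof -
        have "norm (f i (J x)) \<le> 1 / c * norm (J x)" by (rule f_bound')
        also have "\<dots> \<le> 1 / c * (norm x * KJ)" using c KJ(1) by (intro mult_left_mono) auto
        finally show ?thesis by (simp add: mult_ac)
      qed
      have z': "norm (f i (z k)) \<le> 1 / c" for i
        using f_bound'[of i "z k"] z[of k] by (simp add: unit_sphere_def)
      have "norm (f i (J x) * f j (z k) - f j (J x) * f i (z k))
          \<le> 1 / c * KJ * norm x * (1 / c) + 1 / c * KJ * norm x * (1 / c)" for i j
        using c KJ(2) by (intro order.trans[OF norm_triangle_ineq4] add_mono)
          (auto simp only: norm_mult intro!: mult_mono J' z' mult_nonneg_nonneg, auto)
      then have "norm (f i (J x) * f j (z k) - f j (J x) * f i (z k))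
          \<le> 2 * (1 / c * KJ) * (1 / c) * norm x" for i j by (simp add: mult_ac)
      from mult_left_mono[OF this \<alpha>[of k], of "fst p" "snd p"]
      show ?thesis
        using \<alpha>[of k] by (simp add: g_def split_beta norm_mult \<gamma>_def mult.assoc)
    qed
    have g_sum: "(\<Sum>p\<in>{..<N} \<times> {..<N}. norm (g k p x)) = \<alpha> k * \<Phi> (J x) (z k)" for k x
      using \<alpha>[of k] by (simp add: g_def \<Phi>_def split_beta norm_mult sum_distrib_left)
    have "N \<noteq> 0"
    proof
      assume "N = 0"
      then have "z 0 = 0" using z[of 0] by (intro sep) (auto simp: unit_sphere_def)
      then show False using z[of 0] by (simp add: unit_sphere_def)
    qed
    then have ne: "{..<N} \<times> {..<N} \<noteq> {}" by auto
    obtain R where R: "bounded_operator smul smul R"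
      and R_escape: "\<And>x. filterlim (\<lambda>k. \<alpha> k * \<Phi> (J x) (z k)) at_top sequentially \<Longrightarrow>
         filterlim (\<lambda>n. norm ((R ^^ n) x)) at_top sequentially"
      and R_return: "\<And>x r. strict_mono r \<Longrightarrow> (\<lambda>i. \<alpha> (r i) * \<Phi> (J x) (z (r i))) \<longlonglongrightarrow> 0 \<Longrightarrow>
         \<exists>r'::nat \<Rightarrow> nat. strict_mono r' \<and> (\<lambda>i. (R ^^ r' i) x) \<longlonglongrightarrow> x"
      by (rule operator_from_block_rotations[where g = g and h = h and v = v and \<gamma> = \<gamma>,
            OF _ ne C_pos h_lin h_bound v_bound biorth g_lin g_bound g_v, unfolded g_sum]) auto
    show ?thesis
    proof (intro exI[of _ R] conjI allI impI)
      show "bounded_operator smul smul R" by (rule R)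
      show "filterlim (\<lambda>n. norm ((R ^^ n) x)) at_top sequentially" if "J x \<in> E" for x
        by (rule R_escape[OF escape[OF that]])
      show "\<exists>r::nat \<Rightarrow> nat. strict_mono r \<and> weakly_converges smul (\<lambda>i. (R ^^ r i) x) x"
        if x: "J x \<in> unit_sphere Y - E" for x
      proof -
        obtain r' :: "nat \<Rightarrow> nat" where "strict_mono r'" "(\<lambda>i. (R ^^ r' i) x) \<longlonglongrightarrow> x"
          using return[OF x] R_return by blast
        then show ?thesis
          by (auto simp: weakly_converges_def bounded_operator_def intro: bounded_linear.tendsto)
      qed
    qed
  qed
qed

end
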